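(* Let $T_{\mathrm{couple}}$ be the coupling time of the reflection/synchronized coupling of $(B,S)$ and $(\widetilde{B},\widetilde{S})$. If $S_0=B_0>\widetilde{B}_0=\widetilde{S}_0$, then for all $\alpha>0$ $$\mathbb{E}\bigl[\exp(-\alpha T_{\mathrm{couple}})\bigr]=1+\sinh\left(\sqrt{\frac{\alpha}{2}}\,(B_0-\widetilde{B}_0)\right)\log\tanh\left(\sqrt{\frac{\alpha}{2}}\,\frac{B_0-\widetilde{B}_0}{2}\right).$$
   Context: $B$ is a real Brownian motion with $S_t=\max\{S_0,\sup_{s\le t}B_s\}$, and $(\widetilde{B},\widetilde{S})$ is a copy with $\widetilde{S}_t=\max\{\widetilde{S}_0,\sup_{s\le t}\widetilde{B}_s\}$. (By the L\'evy transform $B=L^{(0)}-|X|$, $S=L^{(0)}$, this is equivalent to coupling a Brownian motion $X$ together with its local time $L^{(0)}$ at $0$.) Reflection/synchronized coupling (with $B_0\ge\widetilde{B}_0$). Stage 1 (reflection): $d\widetilde{B}=-dB$ until $T_1=\inf\{t:B_t=\widetilde{B}_t\}$. Stage 2 (synchronization), if $(B,S)$ and $(\widetilde{B},\widetilde{S})$ do not yet agree: $d\widetilde{B}=+dB$ from time $T_1$ until $T_2=\inf\{t>T_1: B_t\equiv\widetilde{B}_t=S_{T_1}\vee\widetilde{S}_0\}$. The coupling time $T_{\mathrm{couple}}$ is the first time at which $(B,S)=(\widetilde{B},\widetilde{S})$; when $S_0\ne\widetilde{S}_0$ it is $T_2$. *)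

theory Defs
  imports "HOL-Probability.Probability"
begin

locale brownian_motion = prob_space M for M :: "'a measure" +
  fixes B :: "real \<Rightarrow> 'a \<Rightarrow> real" and x :: real
  assumes random_variable_B: "\<And>t. 0 \<le> t \<Longrightarrow> random_variable borel (B t)"
    and continuous_paths: "\<And>\<omega>. \<omega> \<in> space M \<Longrightarrow> continuous_on {0..} (\<lambda>t. B t \<omega>)"
    and start: "AE \<omega> in M. B 0 \<omega> = x"
    and normal_increments: "\<And>s t. 0 \<le> s \<Longrightarrow> s < t \<Longrightarrow>
      distributed M lborel (\<lambda>\<omega>. B t \<omega> - B s \<omega>) (normal_density 0 (sqrt (t - s)))"
    and independent_increments: "\<And>(n::nat) \<tau>. 0 \<le> \<tau> 0 \<Longrightarrow> strict_mono_on {..n} \<tau> \<Longrightarrow>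
      indep_vars (\<lambda>_. borel) (\<lambda>i \<omega>. B (\<tau> (Suc i)) \<omega> - B (\<tau> i) \<omega>) {..<n}"

text \<open>The process \<open>S\<close> started from \<open>s0\<close> and driven by \<open>B\<close>. Its value at time 0 is \<open>s0\<close>
  as soon as \<open>B 0 \<omega> \<le> s0\<close>.\<close>

definition running_max :: "real \<Rightarrow> (real \<Rightarrow> 'a \<Rightarrow> real) \<Rightarrow> real \<Rightarrow> 'a \<Rightarrow> real" where
  "running_max s0 B t \<omega> = max s0 (SUP s\<in>{0..t}. B s \<omega>)"

text \<open>Random times are extended real valued: an infimum over an empty set of times is \<open>\<infinity>\<close>.\<close>

definition meeting_time :: "(real \<Rightarrow> 'a \<Rightarrow> real) \<Rightarrow> (real \<Rightarrow> 'a \<Rightarrow> real) \<Rightarrow> 'a \<Rightarrow> ereal" where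
  "meeting_time B B' \<omega> = Inf {ereal t | t. 0 \<le> t \<and> B t \<omega> = B' t \<omega>}"

text \<open>Below, \<open>S\<close> is only evaluated at \<open>meeting_time B B' \<omega>\<close> if that time is finite; otherwise
  the set of times is empty.\<close>

definition synchronization_time ::
  "real \<Rightarrow> real \<Rightarrow> (real \<Rightarrow> 'a \<Rightarrow> real) \<Rightarrow> (real \<Rightarrow> 'a \<Rightarrow> real) \<Rightarrow> 'a \<Rightarrow> ereal" where
  "synchronization_time s0 s0' B B' \<omega> =
    Inf {ereal t | t. meeting_time B B' \<omega> < ereal t \<and> B t \<omega> = B' t \<omega> \<and>
      B' t \<omega> = max (running_max s0 B (real_of_ereal (meeting_time B B' \<omega>)) \<omega>) s0'}"

definition coupling_time ::
  "real \<Rightarrow> real \<Rightarrow> (real \<Rightarrow> 'a \<Rightarrow> real) \<Rightarrow> (real \<Rightarrow> 'a \<Rightarrow> real) \<Rightarrow> 'a \<Rightarrow> ereal" where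
  "coupling_time s0 s0' B B' \<omega> =
    Inf {ereal t | t. 0 \<le> t \<and>
      (B t \<omega>, running_max s0 B t \<omega>) = (B' t \<omega>, running_max s0' B' t \<omega>)}"

text \<open>The relations \<open>dB' = - dB\<close> and \<open>dB' = dB\<close> on a random time interval are expressed through
  increments over all subintervals. How the two processes continue after the coupling time is not
  prescribed, except that each of them is a Brownian motion.\<close>

locale reflection_synchronized_coupling =
  B: brownian_motion M B b0 + B': brownian_motion M B' b0'
  for M :: "'a measure" and B B' :: "real \<Rightarrow> 'a \<Rightarrow> real" and b0 b0' :: real +
  fixes s0 s0' :: real
  assumes start_order: "b0' \<le> b0" and start_max: "b0 \<le> s0" "b0' \<le> s0'"
    and reflection: "AE \<omega> in M. \<forall>s t. 0 \<le> s \<and> s \<le> t \<and> ereal t \<le> meeting_time B B' \<omega> \<longrightarrow>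
      B' t \<omega> - B' s \<omega> = - (B t \<omega> - B s \<omega>)"
    and synchronization: "AE \<omega> in M. \<forall>T1. meeting_time B B' \<omega> = ereal T1 \<and>
      (B T1 \<omega>, running_max s0 B T1 \<omega>) \<noteq> (B' T1 \<omega>, running_max s0' B' T1 \<omega>) \<longrightarrow>
      (\<forall>s t. T1 \<le> s \<and> s \<le> t \<and> ereal t \<le> synchronization_time s0 s0' B B' \<omega> \<longrightarrow>
        B' t \<omega> - B' s \<omega> = B t \<omega> - B s \<omega>)"

text \<open>The value of \<open>exp (- \<alpha> * T)\<close> for \<open>\<alpha> > 0\<close>, with the convention \<open>exp (- \<infinity>) = 0\<close>.\<close>

definition exp_discount :: "real \<Rightarrow> ereal \<Rightarrow> real" where
  "exp_discount \<alpha> T = (if T = \<infinity> then 0 else exp (- \<alpha> * real_of_ereal T))"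

end

theory Submission
  imports Defs
begin

text \<open>
  Put \<open>W = B - B 0\<close>, \<open>a = (b0 - b0') / 2\<close> and \<open>c = sqrt (2 * \<alpha>)\<close>. During reflection the two
  processes are mirror images about \<open>b0 - a\<close>, so they meet when \<open>W\<close> first hits \<open>- a\<close>, at a time
  \<open>H\<close>. At that moment the maximum of \<open>B\<close> is \<open>b0 + X\<close> with \<open>X = max W\<close> over \<open>[0, H]\<close>, whereas the
  maximum of \<open>B'\<close> is still below \<open>b0\<close>. Afterwards both processes move together, and the maxima
  agree as soon as the common path climbs back to \<open>b0 + X\<close>. Hence the coupling time is a functional
  of \<open>W\<close> alone: the first time \<open>T\<close> at which \<open>W\<close> has visited \<open>- a\<close> and is at its running maximum
  (lemma \<open>coupling_time_eq_return\<close>).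

  The law of \<open>T\<close> comes from the exponential martingales \<open>exp (\<theta> * W t - \<theta>\<^sup>2 / 2 * t)\<close> with
  \<open>\<theta> = c\<close> and \<open>\<theta> = - c\<close>, for which \<open>\<theta>\<^sup>2 / 2 = \<alpha>\<close>. Sampling both of them when \<open>W\<close> leaves
  \<open>(- a, b)\<close> gives two linear equations, whose solution is
  \<open>E [exp (- \<alpha> H); X < b] = sinh (c b) / sinh (c (b + a))\<close>.
  Sampling the one with \<open>\<theta> = c\<close> at \<open>H\<close> and at \<open>T\<close>, with weight \<open>exp (- c X)\<close>, gives
  \<open>E exp (- \<alpha> T) = exp (- c a) * E [exp (- \<alpha> H) * exp (- c X)]\<close>, because \<open>W\<close> equals \<open>X\<close> at \<open>T\<close>
  and \<open>- a\<close> at \<open>H\<close>. Writing \<open>exp (- c X)\<close> as the integral of \<open>c * exp (- c b)\<close> over \<open>b > X\<close> and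
  exchanging the integrals reduces the claim to an elementary integral with the antiderivative
  \<open>- exp (- c b) - sinh (c a) * ln (tanh (c (b + a) / 2))\<close>.

  Two facts about Brownian motion carry this. An increment is independent of the sigma-algebra of
  the whole past (lemma \<open>past_indep_increment\<close>); it is obtained from independence of finitely many
  increments through dyadic grids. And the exponential martingale may be sampled at bounded stopping
  times with a weight that is known at the earlier one (lemma \<open>optional_sampling\<close>); it is obtained
  by rounding the times up to dyadic grids, where it is a finite sum of centred terms, and a uniform
  bound on second moments permits the passage to the limit.
\<close>

section \<open>Running maxima and first zeros of a continuous path\<close>

lemma dyadic_floor_tendsto:
  fixes r :: real
  shows "(\<lambda>n. of_int \<lfloor>r * 2 ^ n\<rfloor> / 2 ^ n) \<longlonglongrightarrow> r"
proof (rule tendsto_sandwich)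
  have "(\<lambda>n. r - (1/2) ^ n) \<longlonglongrightarrow> r - 0"
    by (intro tendsto_intros LIMSEQ_power_zero) auto
  then show "(\<lambda>n. r - (1/2) ^ n) \<longlonglongrightarrow> r" by simp
  show "\<forall>\<^sub>F n in sequentially. r - (1/2) ^ n \<le> of_int \<lfloor>r * 2 ^ n\<rfloor> / 2 ^ n"
  proof (rule always_eventually, rule allI)
    fix n :: nat
    have "r * 2 ^ n - 1 \<le> of_int \<lfloor>r * 2 ^ n\<rfloor>" by linarith
    then have "(r * 2 ^ n - 1) / 2 ^ n \<le> of_int \<lfloor>r * 2 ^ n\<rfloor> / 2 ^ n"
      by (rule divide_right_mono) simp
    then show "r - (1/2) ^ n \<le> of_int \<lfloor>r * 2 ^ n\<rfloor> / 2 ^ n"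
      by (simp add: diff_divide_distrib power_divide)
  qed
  show "\<forall>\<^sub>F n in sequentially. of_int \<lfloor>r * 2 ^ n\<rfloor> / 2 ^ n \<le> r"
    by (auto intro!: always_eventually simp: field_simps)
qed auto

lemma dyadic_ceiling_tendsto:
  fixes r :: real
  shows "(\<lambda>n. of_int \<lceil>r * 2 ^ n\<rceil> / 2 ^ n) \<longlonglongrightarrow> r"
  using tendsto_minus[OF dyadic_floor_tendsto[of "- r"]] by (simp add: ceiling_def)

lemma dyadic_approximation:
  fixes s t :: real
  assumes s: "0 \<le> s" "s \<le> t"
  obtains k :: "nat \<Rightarrow> nat"
  where "\<And>n. k n \<le> 2 ^ n" "(\<lambda>n. t * (real (k n) / 2 ^ n)) \<longlonglongrightarrow> s"
proof
  define r where "r = (if t = 0 then 0 else s / t)"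
  have r: "0 \<le> r" "r \<le> 1" "t * r = s" using s by (auto simp: r_def)
  define k where "k n = nat \<lfloor>r * 2 ^ n\<rfloor>" for n
  have k: "real (k n) = of_int \<lfloor>r * 2 ^ n\<rfloor>" for n
    using r by (simp add: k_def)
  show "k n \<le> 2 ^ n" for n
  proof -
    have "r * 2 ^ n \<le> 2 ^ n" using r by simp
    then have "real (k n) \<le> 2 ^ n" unfolding k by linarith
    then show ?thesis by (metis of_nat_le_iff of_nat_numeral of_nat_power)
  qed
  show "(\<lambda>n. t * (real (k n) / 2 ^ n)) \<longlonglongrightarrow> s"
    unfolding k r(3)[symmetric] by (intro tendsto_intros dyadic_floor_tendsto)
qed

definition run_max :: "(real \<Rightarrow> real) \<Rightarrow> real \<Rightarrow> real" where
  "run_max f t = (SUP s\<in>{0..t}. f s)"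

lemma run_max_bdd:
  fixes f :: "real \<Rightarrow> real"
  assumes "continuous_on {0..} f"
  shows "bdd_above (f ` {0..t})"
proof -
  have "compact (f ` {0..t})"
    by (rule compact_continuous_image[OF continuous_on_subset[OF assms]]) auto
  then show ?thesis by (intro bounded_imp_bdd_above compact_imp_bounded)
qed

lemma run_max_upper:
  assumes "continuous_on {0..} f" "0 \<le> s" "s \<le> t"
  shows "f s \<le> run_max f t"
  unfolding run_max_def by (rule cSUP_upper[OF _ run_max_bdd[OF assms(1)]]) (use assms in auto)

lemma run_max_attained:
  assumes "continuous_on {0..} f" "0 \<le> t"
  obtains s where "0 \<le> s" "s \<le> t" "run_max f t = f s"
proof -
  have "\<exists>s\<in>{0..t}. \<forall>y\<in>{0..t}. f y \<le> f s"
    by (rule continuous_attains_sup) (use assms in \<open>auto intro: continuous_on_subset\<close>)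
  then obtain s where s: "s \<in> {0..t}" "\<And>y. y \<in> {0..t} \<Longrightarrow> f y \<le> f s" by blast
  have "run_max f t \<le> f s"
    unfolding run_max_def by (rule cSUP_least) (use s assms in auto)
  with run_max_upper[OF assms(1), of s t] s show thesis by (intro that[of s]) auto
qed

lemma run_max_mono:
  assumes "continuous_on {0..} f" "0 \<le> s" "s \<le> t"
  shows "run_max f s \<le> run_max f t"
  by (metis assms order_trans run_max_attained run_max_upper)

lemma run_max_less_iff:
  assumes "continuous_on {0..} f" "0 \<le> t"
  shows "run_max f t < c \<longleftrightarrow> (\<forall>s. 0 \<le> s \<and> s \<le> t \<longrightarrow> f s < c)"
  by (metis assms order_le_less_trans run_max_attained run_max_upper)

lemma run_max_ge_iff:
  assumes "continuous_on {0..} f" "0 \<le> t"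
  shows "c \<le> run_max f t \<longleftrightarrow> (\<exists>s. 0 \<le> s \<and> s \<le> t \<and> c \<le> f s)"
  using run_max_less_iff[OF assms, of c] by (simp add: not_less[symmetric])

lemma continuous_on_run_max:
  assumes f: "continuous_on {0..} f"
  shows "continuous_on {0..} (run_max f)"
  unfolding continuous_on_iff
proof (intro ballI allI impI)
  fix t e :: real assume t: "t \<in> {0..}" and e: "0 < e"
  obtain d where d: "d > 0" "\<And>s. 0 \<le> s \<Longrightarrow> \<bar>s - t\<bar> < d \<Longrightarrow> \<bar>f s - f t\<bar> < e / 2"
    using f t e unfolding continuous_on_iff dist_real_def
    by (metis atLeast_iff half_gt_zero)
  \<comment> \<open>Between two nearby times the maximum can only grow through values of \<open>f\<close> that are close
    to the value at the earlier time, and that value it already dominates.\<close>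
  have key: "run_max f v < run_max f u + e"
    if u: "0 \<le> u" "\<bar>u - t\<bar> < d" and v: "u \<le> v" "\<bar>v - t\<bar> < d" for u v
  proof -
    obtain s where s: "0 \<le> s" "s \<le> v" "run_max f v = f s"
      using run_max_attained[OF f, of v] u v by auto
    have "f s < run_max f u + e"
    proof (cases "s \<le> u")
      case True
      with run_max_upper[OF f s(1), of u] e show ?thesis by auto
    next
      case False
      then have "\<bar>s - t\<bar> < d" using u v s by auto
      with d(2)[of s] d(2)[of u] u s have "\<bar>f s - f t\<bar> < e / 2" "\<bar>f u - f t\<bar> < e / 2"
        by auto
      then have "f s < f u + e" by linarith
      with run_max_upper[OF f, of u u] u show ?thesis by auto
    qed
    with s show ?thesis by simp
  qed
  show "\<exists>d>0. \<forall>s\<in>{0..}. dist s t < d \<longrightarrow> dist (run_max f s) (run_max f t) < e"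
  proof (intro exI conjI ballI impI)
    fix s assume s: "s \<in> {0..}" "dist s t < d"
    show "dist (run_max f s) (run_max f t) < e"
    proof (cases "s \<le> t")
      case True
      with key[of s t] run_max_mono[OF f, of s t] s t d show ?thesis
        by (auto simp: dist_real_def)
    next
      case False
      with key[of t s] run_max_mono[OF f, of t s] s t d show ?thesis
        by (auto simp: dist_real_def)
    qed
  qed (rule d)
qed

text \<open>A supremum over countably many sampling points is what yields measurability of the running
  maximum.\<close>

lemma run_max_countable:
  assumes f: "continuous_on {0..} f" and t: "0 \<le> t"
  shows "run_max f t = (SUP (k::nat, n::nat)\<in>{(k, n). k \<le> 2 ^ n}. f (t * (real k / 2 ^ n)))"
    (is "_ = Sup (?g ` ?I)")
proof (rule antisym)
  have le: "0 \<le> t * (real k / 2 ^ n) \<and> t * (real k / 2 ^ n) \<le> t" if "k \<le> 2 ^ n" for k n :: nat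
  proof -
    have "real k \<le> 2 ^ n" using that by (metis of_nat_le_iff of_nat_numeral of_nat_power)
    then have "real k / 2 ^ n \<le> 1" by simp
    then show ?thesis using t mult_left_le[of "real k / 2 ^ n" t] by simp
  qed
  have bdd: "bdd_above (?g ` ?I)"
    by (rule bdd_above_mono[OF run_max_bdd[OF f, of t]]) (use le in auto)
  have I0: "(0, 0) \<in> ?I" by simp
  show "Sup (?g ` ?I) \<le> run_max f t"
    by (rule cSUP_least) (use I0 run_max_upper[OF f] le in auto)
  obtain s where s: "0 \<le> s" "s \<le> t" "run_max f t = f s"
    using run_max_attained[OF f t] .
  obtain k :: "nat \<Rightarrow> nat" where kle: "\<And>n. k n \<le> 2 ^ n"
    and klim: "(\<lambda>n. t * (real (k n) / 2 ^ n)) \<longlonglongrightarrow> s"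
    using dyadic_approximation[OF s(1,2)] by blast
  have "(\<lambda>n. f (t * (real (k n) / 2 ^ n))) \<longlonglongrightarrow> f s"
    by (rule continuous_on_tendsto_compose[OF f klim]) (use s t in auto)
  then show "run_max f t \<le> Sup (?g ` ?I)"
    unfolding s(3)
  proof (rule LIMSEQ_le_const2, intro exI allI impI)
    fix n
    have "(k n, n) \<in> ?I" using kle by simp
    from cSUP_upper[OF this bdd] show "f (t * (real (k n) / 2 ^ n)) \<le> Sup (?g ` ?I)" by simp
  qed
qed

text \<open>The first time in \<open>[0, t]\<close> at which \<open>f\<close> is nonpositive, and \<open>t\<close> itself if there is none. Capping at
  the horizon keeps the time real valued and bounded, as optional sampling requires.\<close>

definition first_hit :: "(real \<Rightarrow> real) \<Rightarrow> real \<Rightarrow> real" where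
  "first_hit f t = Inf (insert t {u\<in>{0..t}. f u \<le> 0})"

lemma first_hit_bounds:
  assumes "0 \<le> t"
  shows "0 \<le> first_hit f t" "first_hit f t \<le> t"
  unfolding first_hit_def
   apply (rule cInf_greatest; use assms in auto)
  apply (rule cInf_lower; use assms in \<open>auto intro!: bdd_belowI[of _ 0]\<close>)
  done

lemma first_hit_eq_horizon:
  assumes "\<And>u. 0 \<le> u \<Longrightarrow> u < t \<Longrightarrow> 0 < f u"
  shows "first_hit f t = t"
proof -
  have "u = t" if "u \<in> {0..t}" "f u \<le> 0" for u
    using assms[of u] that by (cases "u = t") auto
  then have eq: "insert t {u\<in>{0..t}. f u \<le> 0} = {t}" by blast
  show ?thesis unfolding first_hit_def eq by simp
qed

lemma first_hit_eq_zero: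
  assumes "0 \<le> T" "f T \<le> 0" "\<And>u. 0 \<le> u \<Longrightarrow> u < T \<Longrightarrow> 0 < f u" "T \<le> t"
  shows "first_hit f t = T"
  unfolding first_hit_def
  by (rule cInf_eq_minimum) (use assms in \<open>auto simp: not_less[symmetric]\<close>)

lemma first_zero_exists:
  fixes f :: "real \<Rightarrow> real"
  assumes f: "continuous_on {0..} f" and u: "0 \<le> u" "f u \<le> 0"
  obtains T where "0 \<le> T" "T \<le> u" "f T \<le> 0" "\<And>v. 0 \<le> v \<Longrightarrow> v < T \<Longrightarrow> 0 < f v"
proof -
  define K where "K = {0..u} \<inter> f -` {..0}"
  have "closed K"
    unfolding K_def by (intro continuous_closed_preimage continuous_on_subset[OF f]) auto
  moreover have "bounded K"
    by (rule bounded_subset[of "{0..u}"]) (auto simp: K_def)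
  ultimately have "compact K" by (simp add: compact_eq_bounded_closed)
  moreover have "u \<in> K" using u by (simp add: K_def)
  ultimately obtain T where T: "T \<in> K" "\<And>v. v \<in> K \<Longrightarrow> T \<le> v"
    using compact_attains_inf[of K] by blast
  show thesis
  proof (rule that[of T])
    fix v assume v: "0 \<le> v" "v < T"
    show "0 < f v"
    proof (rule ccontr)
      assume "\<not> 0 < f v"
      with v T(1) have "v \<in> K" by (simp add: K_def)
      from T(2)[OF this] v show False by simp
    qed
  qed (use T(1) in \<open>auto simp: K_def\<close>)
qed

lemma first_hit_le_iff:
  fixes f :: "real \<Rightarrow> real"
  assumes f: "continuous_on {0..} f" and s: "0 \<le> s" "s < t"
  shows "first_hit f t \<le> s \<longleftrightarrow> (\<exists>u. 0 \<le> u \<and> u \<le> s \<and> f u \<le> 0)"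
proof
  assume le: "first_hit f t \<le> s"
  show "\<exists>u. 0 \<le> u \<and> u \<le> s \<and> f u \<le> 0"
  proof (rule ccontr)
    assume no: "\<not> ?thesis"
    show False
    proof (cases "\<exists>u. 0 \<le> u \<and> u \<le> t \<and> f u \<le> 0")
      case True
      then obtain u where u: "0 \<le> u" "u \<le> t" "f u \<le> 0" by blast
      obtain T where T: "0 \<le> T" "T \<le> u" "f T \<le> 0" "\<And>v. 0 \<le> v \<Longrightarrow> v < T \<Longrightarrow> 0 < f v"
        using first_zero_exists[OF f u(1,3)] by blast
      from first_hit_eq_zero[of T f t] T u le no show False by auto
    next
      case False
      then have "0 < f u" if "0 \<le> u" "u < t" for u
        using that False by (meson less_imp_le not_le)
      then have "first_hit f t = t" by (rule first_hit_eq_horizon)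
      with le s show False by simp
    qed
  qed
next
  assume "\<exists>u. 0 \<le> u \<and> u \<le> s \<and> f u \<le> 0"
  then obtain u where u: "0 \<le> u" "u \<le> s" "f u \<le> 0" by blast
  have "first_hit f t \<le> u"
    unfolding first_hit_def
    by (rule cInf_lower) (use u s in \<open>auto intro!: bdd_belowI[of _ 0]\<close>)
  with u show "first_hit f t \<le> s" by simp
qed

lemma before_first_hit:
  fixes f :: "real \<Rightarrow> real"
  assumes f: "continuous_on {0..} f" and u: "0 \<le> u" "u < first_hit f t" and t: "0 \<le> t"
  shows "0 < f u"
proof (rule ccontr)
  assume "\<not> 0 < f u"
  moreover have "u < t" using u(2) first_hit_bounds(2)[OF t, of f] by simp
  ultimately have "first_hit f t \<le> u"
    using first_hit_le_iff[OF f u(1), of t] u by auto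
  with u show False by simp
qed

lemma first_zero_value:
  fixes f :: "real \<Rightarrow> real"
  assumes f: "continuous_on {0..} f" "0 \<le> f 0"
    and T: "0 \<le> T" "\<And>v. 0 \<le> v \<Longrightarrow> v < T \<Longrightarrow> 0 < f v"
  shows "0 \<le> f T"
proof (cases "T = 0")
  case False
  with T have "0 < T" by simp
  show ?thesis
  proof (rule ccontr)
    assume "\<not> 0 \<le> f T"
    then have neg: "f T < 0" by simp
    have "\<exists>v\<ge>0. v \<le> T \<and> f v = f T / 2"
    proof (rule IVT2')
      show "f T \<le> f T / 2" "f T / 2 \<le> f 0" using neg f(2) by simp_all
    qed (use T in \<open>auto intro: continuous_on_subset[OF f(1)]\<close>)
    then obtain v where v: "0 \<le> v" "v \<le> T" "f v = f T / 2" by blast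
    with neg have "v \<noteq> T" by auto
    with v T(2)[of v] neg show False by simp
  qed
qed (use f in simp)

definition first_zero :: "(real \<Rightarrow> real) \<Rightarrow> real" where
  "first_zero f = Inf {u. 0 \<le> u \<and> f u \<le> 0}"

definition has_zero :: "(real \<Rightarrow> real) \<Rightarrow> bool" where
  "has_zero f \<longleftrightarrow> (\<exists>u\<ge>0. f u \<le> 0)"

text \<open>The value of \<open>exp (- \<alpha> * T)\<close> at the first time \<open>T\<close> with \<open>f T \<le> 0\<close>, where \<open>T = \<infinity>\<close> if no such time
  exists.\<close>

definition zero_discount :: "real \<Rightarrow> (real \<Rightarrow> real) \<Rightarrow> real" where
  "zero_discount \<alpha> f = (if has_zero f then exp (- \<alpha> * first_zero f) else 0)"

lemma first_zero_eq:
  assumes "0 \<le> T" "f T \<le> 0" "\<And>v. 0 \<le> v \<Longrightarrow> v < T \<Longrightarrow> 0 < f v"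
  shows "first_zero f = T"
  unfolding first_zero_def
  by (rule cInf_eq_minimum) (use assms in \<open>auto simp: not_less[symmetric]\<close>)

lemma has_zeroD:
  fixes f :: "real \<Rightarrow> real"
  assumes f: "continuous_on {0..} f" and z: "has_zero f"
  shows "0 \<le> first_zero f" "f (first_zero f) \<le> 0"
    and "\<And>v. 0 \<le> v \<Longrightarrow> v < first_zero f \<Longrightarrow> 0 < f v"
    and "\<And>t. first_zero f \<le> t \<Longrightarrow> first_hit f t = first_zero f"
proof -
  obtain u where u: "0 \<le> u" "f u \<le> 0" using z by (auto simp: has_zero_def)
  obtain T where T: "0 \<le> T" "T \<le> u" "f T \<le> 0" "\<And>v. 0 \<le> v \<Longrightarrow> v < T \<Longrightarrow> 0 < f v"
    using first_zero_exists[OF f u] by blast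
  have "first_zero f = T" by (rule first_zero_eq[of T f]) (use T in auto)
  then show "0 \<le> first_zero f" "f (first_zero f) \<le> 0"
    "\<And>v. 0 \<le> v \<Longrightarrow> v < first_zero f \<Longrightarrow> 0 < f v"
    "\<And>t. first_zero f \<le> t \<Longrightarrow> first_hit f t = first_zero f"
    using T first_hit_eq_zero[of T f] by auto
qed

lemma no_zeroD:
  fixes f :: "real \<Rightarrow> real"
  assumes "\<not> has_zero f"
  shows "\<And>v. 0 \<le> v \<Longrightarrow> 0 < f v" and "\<And>t. first_hit f t = t"
proof -
  show pos: "0 < f v" if "0 \<le> v" for v using assms that by (meson has_zero_def not_le)
  show "first_hit f t = t" for t by (rule first_hit_eq_horizon) (use pos in auto)
qed

lemma first_hit_nonneg:
  fixes f :: "real \<Rightarrow> real"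
  assumes f: "continuous_on {0..} f" "0 \<le> f 0" and t: "0 \<le> t"
  shows "0 \<le> f (first_hit f t)"
  by (rule first_zero_value[OF f first_hit_bounds(1)[OF t]])
    (use before_first_hit[OF f(1) _ _ t] in auto)

text \<open>The maximum increases only while the path sits on it. If it had increased, the intermediate value
  theorem would supply a level strictly in between, and the path is at its maximum when it first
  attains that level.\<close>

lemma run_max_constant:
  assumes f: "continuous_on {0..} f" and H: "0 \<le> H" "H \<le> t"
    and below: "\<And>u. H \<le> u \<Longrightarrow> u < t \<Longrightarrow> f u < run_max f u"
  shows "run_max f t = run_max f H"
proof (rule ccontr)
  assume "run_max f t \<noteq> run_max f H"
  with run_max_mono[OF f H] have less: "run_max f H < run_max f t" by simp
  define l where "l = (run_max f H + run_max f t) / 2"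
  have l: "run_max f H < l" "l < run_max f t" using less by (simp_all add: l_def)
  have "\<exists>w\<ge>H. w \<le> t \<and> run_max f w = l"
    by (rule IVT') (use l H in \<open>auto intro: continuous_on_subset[OF continuous_on_run_max[OF f]]\<close>)
  then obtain w where w: "H \<le> w" "w \<le> t" "run_max f w = l" by blast
  with l have wt: "w < t" by (cases "w = t") auto
  obtain v where v: "0 \<le> v" "v \<le> w" "run_max f w = f v"
    using run_max_attained[OF f, of w] w H by auto
  have "H < v"
  proof (rule ccontr)
    assume "\<not> H < v"
    with run_max_upper[OF f v(1), of H] v w l show False by simp
  qed
  moreover have "run_max f v \<le> f v" using run_max_mono[OF f v(1,2)] v(3) by simp
  ultimately show False using below[of v] v wt by simp
qed

section \<open>The return to the running maximum after a descent\<close>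

text \<open>Nonpositive exactly when \<open>f\<close> has been at or below \<open>- a\<close> and is now at its running maximum.
  Packing both conditions into one continuous function makes the return time a first zero, so
  that it is a stopping time for the same reason as an ordinary hitting time.\<close>

definition return_gap :: "real \<Rightarrow> (real \<Rightarrow> real) \<Rightarrow> real \<Rightarrow> real" where
  "return_gap a f u = max (a - run_max (\<lambda>s. - f s) u) (run_max f u - f u)"

lemma continuous_on_return_gap:
  assumes f: "continuous_on {0..} f"
  shows "continuous_on {0..} (return_gap a f)"
  unfolding return_gap_def
  by (intro continuous_intros continuous_on_run_max f)

lemma return_gap_nonpos_iff:
  assumes f: "continuous_on {0..} f" and u: "0 \<le> u"
  shows "return_gap a f u \<le> 0 \<longleftrightarrow> (\<exists>v. 0 \<le> v \<and> v \<le> u \<and> f v + a \<le> 0) \<and> run_max f u \<le> f u"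
proof -
  have "a \<le> run_max (\<lambda>s. - f s) u \<longleftrightarrow> (\<exists>v. 0 \<le> v \<and> v \<le> u \<and> a \<le> - f v)"
    by (rule run_max_ge_iff) (use f u in \<open>auto intro: continuous_intros\<close>)
  moreover have "a \<le> - f v \<longleftrightarrow> f v + a \<le> 0" for v by linarith
  ultimately show ?thesis by (simp add: return_gap_def)
qed

lemma continuous_shift: "continuous_on {0..} f \<Longrightarrow> continuous_on {0..} (\<lambda>u. f u + a :: real)"
  by (intro continuous_intros)

lemma first_hit_le_return:
  assumes f: "continuous_on {0..} f" and t: "0 \<le> t"
  shows "first_hit (\<lambda>u. f u + a) t \<le> first_hit (return_gap a f) t"
proof (cases "first_hit (return_gap a f) t = t")
  case True
  then show ?thesis using first_hit_bounds(2)[OF t] by simp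
next
  case False
  let ?r = "first_hit (return_gap a f) t"
  have r: "0 \<le> ?r" "?r < t" using first_hit_bounds[OF t, of "return_gap a f"] False by auto
  from first_hit_le_iff[OF continuous_on_return_gap[OF f] r, of a]
  obtain u where "0 \<le> u" "u \<le> ?r" "return_gap a f u \<le> 0" by auto
  then obtain v where "0 \<le> v" "v \<le> ?r" "f v + a \<le> 0"
    unfolding return_gap_nonpos_iff[OF f \<open>0 \<le> u\<close>] by force
  then show ?thesis using first_hit_le_iff[OF continuous_shift[OF f] r, of a] by blast
qed

lemma run_max_before_return:
  assumes f: "continuous_on {0..} f" and H: "0 \<le> H" "f H + a \<le> 0"
    and t: "H \<le> t" "\<And>u. 0 \<le> u \<Longrightarrow> u < t \<Longrightarrow> 0 < return_gap a f u"
  shows "run_max f t = run_max f H"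
proof (rule run_max_constant[OF f H(1) t(1)])
  fix u assume u: "H \<le> u" "u < t"
  with t(2)[of u] return_gap_nonpos_iff[OF f, of u a] H show "f u < run_max f u"
    by (auto simp: not_le[symmetric])
qed

text \<open>From the descent to \<open>- a\<close> until the return, the maximum is frozen at its value at the descent. This
  is the bound that makes the weighted exponential martingale at most 1.\<close>

lemma value_at_return_le:
  assumes f: "continuous_on {0..} f" and t: "0 \<le> t"
  shows "f (first_hit (return_gap a f) t) \<le> run_max f (first_hit (\<lambda>u. f u + a) t)"
proof -
  let ?h = "first_hit (\<lambda>u. f u + a) t" and ?r = "first_hit (return_gap a f) t"
  have h0: "0 \<le> ?h" and r0: "0 \<le> ?r" "?r \<le> t" using first_hit_bounds[OF t] by auto
  have hr: "?h \<le> ?r" by (rule first_hit_le_return[OF f t])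
  show ?thesis
  proof (cases "?h = ?r")
    case True
    then show ?thesis using run_max_upper[OF f h0, of ?h] by simp
  next
    case False
    with hr r0 have "?h < t" by simp
    then obtain v where v: "0 \<le> v" "v \<le> ?h" "f v + a \<le> 0"
      using first_hit_le_iff[OF continuous_shift[OF f] h0, of t a] by auto
    have "v = ?h" using before_first_hit[OF continuous_shift[OF f] v(1), of a t] v t by force
    with v have H: "f ?h + a \<le> 0" by simp
    have "run_max f ?r = run_max f ?h"
      by (rule run_max_before_return[OF f h0 H hr])
        (rule before_first_hit[OF continuous_on_return_gap[OF f] _ _ t])
    then show ?thesis using run_max_upper[OF f r0(1), of ?r] by simp
  qed
qed

section \<open>Measurability of maxima and first zeros\<close>

lemma run_max_measurable:
  fixes Y :: "real \<Rightarrow> 'a \<Rightarrow> real"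
  assumes cont: "\<And>\<omega>. \<omega> \<in> space N \<Longrightarrow> continuous_on {0..} (\<lambda>u. Y u \<omega>)" and t: "0 \<le> t"
    and meas: "\<And>u. 0 \<le> u \<Longrightarrow> u \<le> t \<Longrightarrow> Y u \<in> borel_measurable N"
  shows "(\<lambda>\<omega>. run_max (\<lambda>u. Y u \<omega>) t) \<in> borel_measurable N"
proof -
  let ?I = "{(k::nat, n::nat). k \<le> 2 ^ n}"
  have le: "t * (real k / 2 ^ n) \<le> t" "0 \<le> t * (real k / 2 ^ n)" if "k \<le> 2 ^ n" for k n :: nat
  proof -
    have "real k \<le> 2 ^ n" using that by (metis of_nat_le_iff of_nat_numeral of_nat_power)
    then have "real k / 2 ^ n \<le> 1" by simp
    then show "t * (real k / 2 ^ n) \<le> t" using t by (intro mult_left_le) auto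
    show "0 \<le> t * (real k / 2 ^ n)" using t by simp
  qed
  have "(\<lambda>\<omega>. SUP p\<in>?I. Y (t * (real (fst p) / 2 ^ snd p)) \<omega>) \<in> borel_measurable N"
  proof (rule borel_measurable_cSUP)
    show "countable ?I" by (rule countable_subset[OF subset_UNIV]) simp
    show "Y (t * (real (fst p) / 2 ^ snd p)) \<in> borel_measurable N" if "p \<in> ?I" for p
      by (rule meas) (use le that in auto)
    fix \<omega> assume "\<omega> \<in> space N"
    from run_max_bdd[OF cont[OF this], of t]
    show "bdd_above ((\<lambda>p. Y (t * (real (fst p) / 2 ^ snd p)) \<omega>) ` ?I)"
      by (rule bdd_above_mono) (use le in auto)
  qed
  then show ?thesis
    by (rule measurable_cong[THEN iffD1, rotated])
      (use run_max_countable[OF cont t] in \<open>auto simp: case_prod_beta'\<close>)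
qed

lemma first_hit_le_measurable:
  fixes Y :: "real \<Rightarrow> 'a \<Rightarrow> real"
  assumes cont: "\<And>\<omega>. \<omega> \<in> space N \<Longrightarrow> continuous_on {0..} (\<lambda>u. Y u \<omega>)" and t: "0 \<le> t"
    and meas: "\<And>u. 0 \<le> u \<Longrightarrow> u \<le> s \<Longrightarrow> Y u \<in> borel_measurable N"
  shows "Measurable.pred N (\<lambda>\<omega>. first_hit (\<lambda>u. Y u \<omega>) t \<le> s)"
proof -
  have bounds: "0 \<le> first_hit (\<lambda>u. Y u \<omega>) t" "first_hit (\<lambda>u. Y u \<omega>) t \<le> t" for \<omega>
    using first_hit_bounds[OF t] by auto
  consider "s < 0" | "t \<le> s" | "0 \<le> s" "s < t" by linarith
  then show ?thesis
  proof cases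
    case 1
    then have "(\<lambda>\<omega>. first_hit (\<lambda>u. Y u \<omega>) t \<le> s) = (\<lambda>_. False)"
      by (intro ext) (use bounds(1) in \<open>auto simp: not_le intro: less_le_trans\<close>)
    then show ?thesis by simp
  next
    case 2
    then have "(\<lambda>\<omega>. first_hit (\<lambda>u. Y u \<omega>) t \<le> s) = (\<lambda>_. True)"
      by (intro ext) (use bounds(2) in \<open>auto intro: order_trans\<close>)
    then show ?thesis by simp
  next
    case 3
    have cont': "continuous_on {0..} (\<lambda>u. - Y u \<omega>)" if "\<omega> \<in> space N" for \<omega>
      by (intro continuous_intros cont that)
    have [measurable]: "(\<lambda>\<omega>. run_max (\<lambda>u. - Y u \<omega>) s) \<in> borel_measurable N"
      by (rule run_max_measurable[OF cont' 3(1)]) (auto intro: meas)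
    have "Measurable.pred N (\<lambda>\<omega>. 0 \<le> run_max (\<lambda>u. - Y u \<omega>) s)" by measurable
    moreover have "0 \<le> run_max (\<lambda>u. - Y u \<omega>) s \<longleftrightarrow> first_hit (\<lambda>u. Y u \<omega>) t \<le> s"
      if "\<omega> \<in> space N" for \<omega>
      using run_max_ge_iff[OF cont'[OF that] 3(1), of 0]
        first_hit_le_iff[OF cont[OF that] 3] by simp
    ultimately show ?thesis by (rule measurable_cong[THEN iffD1, rotated])
  qed
qed

lemma exp_minus_time_tendsto_0:
  fixes w :: "nat \<Rightarrow> real"
  assumes w: "\<And>n. w n \<le> K" and \<alpha>: "0 < \<alpha>"
  shows "(\<lambda>n. exp (w n - \<alpha> * real n)) \<longlonglongrightarrow> 0"
proof (rule tendsto_sandwich[where f = "\<lambda>_. 0"])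
  have "(\<lambda>n. exp K * exp (- \<alpha>) ^ n) \<longlonglongrightarrow> exp K * 0"
    using \<alpha> by (intro tendsto_intros LIMSEQ_power_zero) simp
  then show "(\<lambda>n. exp K * exp (- \<alpha>) ^ n) \<longlonglongrightarrow> 0" by simp
  have "exp (w n - \<alpha> * real n) \<le> exp K * exp (- \<alpha>) ^ n" for n
  proof -
    have "exp (w n - \<alpha> * real n) \<le> exp (K - \<alpha> * real n)" using w[of n] by simp
    also have "\<dots> = exp K * exp (- \<alpha>) ^ n"
      by (simp add: exp_diff exp_minus exp_of_nat_mult[symmetric] mult.commute divide_inverse power_inverse)
    finally show ?thesis .
  qed
  then show "\<forall>\<^sub>F n in sequentially. exp (w n - \<alpha> * real n) \<le> exp K * exp (- \<alpha>) ^ n" by simp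
qed auto

text \<open>The discount factor is the limit, as the horizon grows, of those of the capped times: these
  discount factors tend to 0 on paths that never reach the nonpositive half line.\<close>

lemma measurable_zero_discount:
  fixes Y :: "real \<Rightarrow> 'a \<Rightarrow> real"
  assumes cont: "\<And>\<omega>. \<omega> \<in> space N \<Longrightarrow> continuous_on {0..} (\<lambda>u. Y u \<omega>)"
    and meas: "\<And>u. 0 \<le> u \<Longrightarrow> Y u \<in> borel_measurable N" and \<alpha>: "0 < \<alpha>"
  shows "(\<lambda>\<omega>. zero_discount \<alpha> (\<lambda>u. Y u \<omega>)) \<in> borel_measurable N"
proof (rule borel_measurable_LIMSEQ_real)
  have "(\<lambda>\<omega>. first_hit (\<lambda>u. Y u \<omega>) (real n)) \<in> borel_measurable N" for n
  proof (rule borel_measurableI_le)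
    have "Measurable.pred N (\<lambda>\<omega>. first_hit (\<lambda>u. Y u \<omega>) (real n) \<le> s)" for s
      by (rule first_hit_le_measurable[OF cont]) (auto intro: meas)
    then show "{\<omega> \<in> space N. first_hit (\<lambda>u. Y u \<omega>) (real n) \<le> s} \<in> sets N" for s
      by (simp add: pred_def)
  qed
  then show "(\<lambda>\<omega>. exp (- \<alpha> * first_hit (\<lambda>u. Y u \<omega>) (real n))) \<in> borel_measurable N" for n
    by simp
  fix \<omega> assume \<omega>: "\<omega> \<in> space N"
  show "(\<lambda>n. exp (- \<alpha> * first_hit (\<lambda>u. Y u \<omega>) (real n))) \<longlonglongrightarrow> zero_discount \<alpha> (\<lambda>u. Y u \<omega>)"
  proof (cases "has_zero (\<lambda>u. Y u \<omega>)")
    case True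
    define T where "T = first_zero (\<lambda>u. Y u \<omega>)"
    note z = has_zeroD[OF cont[OF \<omega>] True, folded T_def]
    have "exp (- \<alpha> * first_hit (\<lambda>u. Y u \<omega>) (real n)) = exp (- \<alpha> * T)" if "nat \<lceil>T\<rceil> \<le> n" for n
    proof -
      have "T \<le> real n" using that by linarith
      then show ?thesis by (simp add: z(4))
    qed
    then have "(\<lambda>n. exp (- \<alpha> * first_hit (\<lambda>u. Y u \<omega>) (real n))) \<longlonglongrightarrow> exp (- \<alpha> * T)"
      by (intro tendsto_eventually eventually_sequentiallyI)
    then show ?thesis using True by (simp add: zero_discount_def T_def)
  next
    case False
    then show ?thesis
      using exp_minus_time_tendsto_0[of "\<lambda>_. 0" 0 \<alpha>] \<alpha> by (simp add: no_zeroD(2) zero_discount_def)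
  qed
qed

section \<open>Gaussian exponential moments and limits of expectations\<close>

text \<open>Completing the square turns the exponentially tilted centred density into a shifted normal density.\<close>

lemma normal_density_exp_moment:
  assumes "0 < \<sigma>"
  shows "integrable lborel (\<lambda>x. normal_density 0 \<sigma> x * exp (\<theta> * x))"
    and "(\<integral>x. normal_density 0 \<sigma> x * exp (\<theta> * x) \<partial>lborel) = exp (\<theta>\<^sup>2 * \<sigma>\<^sup>2 / 2)"
proof -
  have shift: "normal_density 0 \<sigma> x * exp (\<theta> * x)
      = exp (\<theta>\<^sup>2 * \<sigma>\<^sup>2 / 2) * normal_density (\<theta> * \<sigma>\<^sup>2) \<sigma> x" for x
  proof -
    have "- x\<^sup>2 / (2 * \<sigma>\<^sup>2) + \<theta> * x = \<theta>\<^sup>2 * \<sigma>\<^sup>2 / 2 - (x - \<theta> * \<sigma>\<^sup>2)\<^sup>2 / (2 * \<sigma>\<^sup>2)"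
      using assms by (simp add: field_simps power2_eq_square)
    then have "exp (- x\<^sup>2 / (2 * \<sigma>\<^sup>2)) * exp (\<theta> * x)
        = exp (\<theta>\<^sup>2 * \<sigma>\<^sup>2 / 2) * exp (- (x - \<theta> * \<sigma>\<^sup>2)\<^sup>2 / (2 * \<sigma>\<^sup>2))"
      by (simp flip: exp_add)
    then show ?thesis by (simp add: normal_density_def mult_ac)
  qed
  show "integrable lborel (\<lambda>x. normal_density 0 \<sigma> x * exp (\<theta> * x))"
    unfolding shift using assms by (intro integrable_mult_right integrable_normal_density)
  show "(\<integral>x. normal_density 0 \<sigma> x * exp (\<theta> * x) \<partial>lborel) = exp (\<theta>\<^sup>2 * \<sigma>\<^sup>2 / 2)"
    unfolding shift using assms integral_normal_density[OF assms, of "\<theta> * \<sigma>\<^sup>2"] by simp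
qed

text \<open>Second moments bounded by \<open>C\<close> make the truncation error at level \<open>L\<close> at most \<open>C / L\<close>, because
  \<open>R - min R L \<le> R\<^sup>2 / L\<close>. By the lemma of Fatou this also holds for the limit, and the truncated
  variables are covered by dominated convergence.\<close>

lemma (in prob_space) expectation_tendsto_of_bounded_second_moment:
  fixes P :: "nat \<Rightarrow> 'a \<Rightarrow> real"
  assumes meas [measurable]: "\<And>n. P n \<in> borel_measurable M"
    and nonneg: "\<And>n \<omega>. \<omega> \<in> space M \<Longrightarrow> 0 \<le> P n \<omega>"
    and sq: "\<And>n. integrable M (\<lambda>\<omega>. (P n \<omega>)\<^sup>2)" "\<And>n. (\<integral>\<omega>. (P n \<omega>)\<^sup>2 \<partial>M) \<le> C"
    and lim: "\<And>\<omega>. \<omega> \<in> space M \<Longrightarrow> (\<lambda>n. P n \<omega>) \<longlonglongrightarrow> Q \<omega>"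
  shows "(\<lambda>n. \<integral>\<omega>. P n \<omega> \<partial>M) \<longlonglongrightarrow> (\<integral>\<omega>. Q \<omega> \<partial>M)"
proof -
  have [measurable]: "Q \<in> borel_measurable M"
    by (rule borel_measurable_LIMSEQ_real[OF lim meas])
  have Q0: "0 \<le> Q \<omega>" if "\<omega> \<in> space M" for \<omega>
    by (rule LIMSEQ_le_const[OF lim[OF that]]) (use nonneg that in auto)
  have C: "0 \<le> C"
    by (rule order_trans[OF _ sq(2)[of 0]]) simp
  have Qsq: "integrable M (\<lambda>\<omega>. (Q \<omega>)\<^sup>2)" "(\<integral>\<omega>. (Q \<omega>)\<^sup>2 \<partial>M) \<le> C"
  proof -
    have "(\<integral>\<^sup>+\<omega>. ennreal ((Q \<omega>)\<^sup>2) \<partial>M) = (\<integral>\<^sup>+\<omega>. liminf (\<lambda>n. ennreal ((P n \<omega>)\<^sup>2)) \<partial>M)"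
    proof (rule nn_integral_cong)
      fix \<omega> assume "\<omega> \<in> space M"
      then have l: "(\<lambda>n. ennreal ((P n \<omega>)\<^sup>2)) \<longlonglongrightarrow> ennreal ((Q \<omega>)\<^sup>2)"
        by (intro tendsto_intros lim)
      then show "ennreal ((Q \<omega>)\<^sup>2) = liminf (\<lambda>n. ennreal ((P n \<omega>)\<^sup>2))"
        by (intro lim_imp_Liminf[OF sequentially_bot l, symmetric])
    qed
    also have "\<dots> \<le> liminf (\<lambda>n. \<integral>\<^sup>+\<omega>. ennreal ((P n \<omega>)\<^sup>2) \<partial>M)"
      by (rule nn_integral_liminf) simp
    also have "\<dots> \<le> liminf (\<lambda>n. ennreal C)"
    proof (rule Liminf_mono, rule always_eventually, rule allI)
      show "(\<integral>\<^sup>+\<omega>. ennreal ((P n \<omega>)\<^sup>2) \<partial>M) \<le> ennreal C" for n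
        using sq(2)[of n] by (subst nn_integral_eq_integral[OF sq(1)]) (auto simp: ennreal_leI)
    qed
    finally have le: "(\<integral>\<^sup>+\<omega>. ennreal ((Q \<omega>)\<^sup>2) \<partial>M) \<le> ennreal C"
      by (simp add: Liminf_const)
    show i: "integrable M (\<lambda>\<omega>. (Q \<omega>)\<^sup>2)"
      by (rule integrableI_nonneg) (use le in \<open>auto simp: top_unique less_top[symmetric] intro: order_le_less_trans\<close>)
    show "(\<integral>\<omega>. (Q \<omega>)\<^sup>2 \<partial>M) \<le> C"
      using le C by (simp add: nn_integral_eq_integral[OF i])
  qed
  have trunc: "integrable M R \<and> \<bar>(\<integral>\<omega>. R \<omega> \<partial>M) - (\<integral>\<omega>. min (R \<omega>) L \<partial>M)\<bar> \<le> C / L"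
    if [measurable]: "R \<in> borel_measurable M" and R0: "\<And>\<omega>. \<omega> \<in> space M \<Longrightarrow> 0 \<le> R \<omega>"
      and Rsq: "integrable M (\<lambda>\<omega>. (R \<omega>)\<^sup>2)" "(\<integral>\<omega>. (R \<omega>)\<^sup>2 \<partial>M) \<le> C" and L: "0 < L"
    for R :: "'a \<Rightarrow> real" and L :: real
  proof -
    have iR: "integrable M R" by (rule square_integrable_imp_integrable) (use Rsq in auto)
    have im: "integrable M (\<lambda>\<omega>. min (R \<omega>) L)"
      by (rule integrable_const_bound[where B = L]) (use L R0 in \<open>auto intro!: AE_I2 simp: abs_le_iff min_def\<close>)
    have pt: "0 \<le> R \<omega> - min (R \<omega>) L \<and> R \<omega> - min (R \<omega>) L \<le> (R \<omega>)\<^sup>2 / L" if "\<omega> \<in> space M" for \<omega>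
    proof (cases "R \<omega> \<le> L")
      case True
      then show ?thesis using L by simp
    next
      case False
      then have "L * R \<omega> \<le> (R \<omega>)\<^sup>2" using R0[OF that] by (simp add: power2_eq_square mult_right_mono)
      then have "R \<omega> \<le> (R \<omega>)\<^sup>2 / L" using L by (simp add: field_simps)
      then show ?thesis using False L by (simp add: min_def)
    qed
    have "(\<integral>\<omega>. R \<omega> - min (R \<omega>) L \<partial>M) \<le> (\<integral>\<omega>. (R \<omega>)\<^sup>2 / L \<partial>M)"
      by (rule integral_mono) (use iR im Rsq pt in auto)
    also have "\<dots> \<le> C / L" using Rsq L by (simp add: divide_right_mono)
    finally have "(\<integral>\<omega>. R \<omega> - min (R \<omega>) L \<partial>M) \<le> C / L" .
    moreover have "0 \<le> (\<integral>\<omega>. R \<omega> - min (R \<omega>) L \<partial>M)"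
      by (rule integral_nonneg_AE) (use pt in auto)
    ultimately show ?thesis using iR im by simp
  qed
  show ?thesis
  proof (rule LIMSEQ_I)
    fix e :: real assume e: "0 < e"
    \<comment> \<open>the summand 1 covers \<open>C = 0\<close>\<close>
    define L where "L = 4 * C / e + 1"
    have L: "0 < L" "C / L \<le> e / 4"
    proof -
      show "0 < L" using C e by (simp add: L_def add_nonneg_pos)
      have "C \<le> e / 4 * L" using e by (simp add: L_def field_simps)
      then show "C / L \<le> e / 4" using \<open>0 < L\<close> by (simp add: pos_divide_le_eq)
    qed
    have "(\<lambda>n. \<integral>\<omega>. min (P n \<omega>) L \<partial>M) \<longlonglongrightarrow> (\<integral>\<omega>. min (Q \<omega>) L \<partial>M)"
    proof (rule integral_dominated_convergence[where w = "\<lambda>_. L"])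
      show "AE \<omega> in M. (\<lambda>n. min (P n \<omega>) L) \<longlonglongrightarrow> min (Q \<omega>) L"
        by (intro AE_I2 tendsto_intros lim)
      show "AE \<omega> in M. norm (min (P n \<omega>) L) \<le> L" for n
        using nonneg L by (intro AE_I2) (auto simp: abs_le_iff min_def intro: order_trans[of _ 0])
    qed auto
    from LIMSEQ_D[OF this, of "e / 4"] e obtain n0 where
      n0: "\<And>n. n \<ge> n0 \<Longrightarrow> \<bar>(\<integral>\<omega>. min (P n \<omega>) L \<partial>M) - (\<integral>\<omega>. min (Q \<omega>) L \<partial>M)\<bar> < e / 4"
      by auto
    show "\<exists>n0. \<forall>n\<ge>n0. norm ((\<integral>\<omega>. P n \<omega> \<partial>M) - (\<integral>\<omega>. Q \<omega> \<partial>M)) < e"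
    proof (intro exI allI impI)
      fix n assume "n0 \<le> n"
      note n0[OF this]
      moreover have "\<bar>(\<integral>\<omega>. P n \<omega> \<partial>M) - (\<integral>\<omega>. min (P n \<omega>) L \<partial>M)\<bar> \<le> C / L"
        using trunc[OF meas nonneg sq L(1), of n] by blast
      moreover have "\<bar>(\<integral>\<omega>. Q \<omega> \<partial>M) - (\<integral>\<omega>. min (Q \<omega>) L \<partial>M)\<bar> \<le> C / L"
        using trunc[OF _ Q0 Qsq L(1)] by simp
      ultimately show "norm ((\<integral>\<omega>. P n \<omega> \<partial>M) - (\<integral>\<omega>. Q \<omega> \<partial>M)) < e"
        using L(2) e unfolding real_norm_def by linarith
    qed
  qed
qed

section \<open>Independence of increments from the past\<close>

context brownian_motion
begin

text \<open>Subtracting the initial value makes the process start at 0 on every path and not only almost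
  surely, so that the pathwise arguments below hold for every sample point.\<close>

definition W :: "real \<Rightarrow> 'a \<Rightarrow> real" where
  "W t \<omega> = B t \<omega> - B 0 \<omega>"

lemma W_0 [simp]: "W 0 \<omega> = 0"
  by (simp add: W_def)

lemma measurable_W: "0 \<le> t \<Longrightarrow> W t \<in> borel_measurable M"
  unfolding W_def[abs_def] using random_variable_B[of t] random_variable_B[of 0] by simp

lemma continuous_W: "\<omega> \<in> space M \<Longrightarrow> continuous_on {0..} (\<lambda>t. W t \<omega>)"
  unfolding W_def by (intro continuous_intros continuous_paths)

definition past :: "real \<Rightarrow> 'a measure" where
  "past s = sigma (space M) (\<Union>u\<in>{0..s}. {W u -` A \<inter> space M |A. A \<in> sets borel})"

lemma space_past [simp]: "space (past s) = space M"
  unfolding past_def by (rule space_measure_of) auto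

lemma sets_past: "sets (past s)
    = sigma_sets (space M) (\<Union>u\<in>{0..s}. {W u -` A \<inter> space M |A. A \<in> sets borel})"
  unfolding past_def by (rule sets_measure_of) auto

lemma sets_past_mono: "s \<le> t \<Longrightarrow> sets (past s) \<subseteq> sets (past t)"
  unfolding sets_past by (rule sigma_sets_mono') force

lemma sets_past_subset: "sets (past s) \<subseteq> sets M"
  unfolding sets_past
  by (rule sets.sigma_sets_subset) (auto intro!: measurable_sets measurable_W)

lemma measurable_past_mono: "f \<in> measurable (past s) N \<Longrightarrow> s \<le> t \<Longrightarrow> f \<in> measurable (past t) N"
  using sets_past_mono[of s t] by (auto simp: measurable_def)

lemma measurable_from_past: "f \<in> measurable (past s) N \<Longrightarrow> f \<in> measurable M N"
  using sets_past_subset[of s] by (auto simp: measurable_def)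

lemma W_measurable_past: "0 \<le> u \<Longrightarrow> u \<le> s \<Longrightarrow> W u \<in> borel_measurable (past s)"
  unfolding measurable_def sets_past by (fastforce intro!: sigma_sets.Basic)

text \<open>The events determined by the values on the dyadic grid of mesh \<open>s / 2 ^ m\<close>. They increase with \<open>m\<close>,
  so their union is stable under intersection, and by continuity of paths it generates the past.\<close>

definition past_grid :: "real \<Rightarrow> nat \<Rightarrow> 'a set set" where
  "past_grid s m = sigma_sets (space M)
     (\<Union>j\<in>{..2 ^ m}. {W (s * (real j / 2 ^ m)) -` A \<inter> space M |A. A \<in> sets borel})"

lemma past_grid_Suc: "past_grid s m \<subseteq> past_grid s (Suc m)"
  unfolding past_grid_def
proof (rule sigma_sets_mono', rule UN_least)
  fix j :: nat assume "j \<in> {..2 ^ m}"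
  then have j: "2 * j \<in> {..2 ^ Suc m}" by simp
  have eq: "s * (real (2 * j) / 2 ^ Suc m) = s * (real j / 2 ^ m)" by simp
  show "{W (s * (real j / 2 ^ m)) -` A \<inter> space M |A. A \<in> sets borel}
      \<subseteq> (\<Union>j\<in>{..2 ^ Suc m}. {W (s * (real j / 2 ^ Suc m)) -` A \<inter> space M |A. A \<in> sets borel})"
    using j eq by (intro subsetI UN_I[of "2 * j"]) (simp_all only: eq)
qed

lemma past_grid_mono: "m \<le> n \<Longrightarrow> past_grid s m \<subseteq> past_grid s n"
  by (rule lift_Suc_mono_le[of "past_grid s"]) (rule past_grid_Suc)

lemma past_grid_subset: "0 \<le> s \<Longrightarrow> past_grid s m \<subseteq> sets M"
  unfolding past_grid_def
  by (rule sets.sigma_sets_subset) (auto intro!: measurable_sets measurable_W)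

lemma sets_past_subset_grid:
  assumes "0 \<le> s"
  shows "sets (past s) \<subseteq> sigma_sets (space M) (\<Union>m. past_grid s m)"
proof -
  define N where "N = sigma (space M) (\<Union>m. past_grid s m)"
  have sub: "(\<Union>m. past_grid s m) \<subseteq> Pow (space M)"
    using past_grid_subset[OF assms] sets.space_closed by blast
  have [simp]: "space N = space M" and sN: "sets N = sigma_sets (space M) (\<Union>m. past_grid s m)"
    unfolding N_def using sub by (simp_all add: space_measure_of sets_measure_of)
  have grid: "W (s * (real j / 2 ^ m)) \<in> borel_measurable N" if j: "j \<le> 2 ^ m" for j m :: nat
  proof (rule measurableI)
    fix A :: "real set" assume A: "A \<in> sets borel"
    have "W (s * (real j / 2 ^ m)) -` A \<inter> space M \<in> past_grid s m"
      unfolding past_grid_def using j A by (intro sigma_sets.Basic) auto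
    then show "W (s * (real j / 2 ^ m)) -` A \<inter> space N \<in> sets N"
      unfolding sN by (auto intro: sigma_sets.Basic)
  qed simp
  have W: "W u \<in> borel_measurable N" if u: "0 \<le> u" "u \<le> s" for u
  proof -
    obtain k :: "nat \<Rightarrow> nat" where k: "\<And>n. k n \<le> 2 ^ n"
      and lim: "(\<lambda>n. s * (real (k n) / 2 ^ n)) \<longlonglongrightarrow> u"
      using dyadic_approximation[OF u] by blast
    show ?thesis
    proof (rule borel_measurable_LIMSEQ_real)
      show "W (s * (real (k n) / 2 ^ n)) \<in> borel_measurable N" for n by (rule grid[OF k])
      fix \<omega> assume "\<omega> \<in> space N"
      then show "(\<lambda>n. W (s * (real (k n) / 2 ^ n)) \<omega>) \<longlonglongrightarrow> W u \<omega>"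
        using assms u
        by (intro continuous_on_tendsto_compose[OF continuous_W lim]) auto
    qed
  qed
  have "sets (past s) \<subseteq> sets N"
    unfolding sets_past
  proof (rule sigma_algebra.sigma_sets_subset)
    show "sigma_algebra (space M) (sets N)"
      using sets.sigma_algebra_axioms[of N] by simp
    show "(\<Union>u\<in>{0..s}. {W u -` A \<inter> space M |A. A \<in> sets borel}) \<subseteq> sets N"
      using measurable_sets[OF W] by auto
  qed
  then show ?thesis unfolding sN .
qed

text \<open>The grid points followed by \<open>t\<close> form one increasing sequence of times, to which independence of
  increments applies; the values on the grid are partial sums of all increments but the last.\<close>

lemma past_grid_indep_increment:
  assumes s: "0 < s" "s < t"
    and a: "a \<in> past_grid s m" and C: "C \<in> sets borel"
  shows "prob (a \<inter> ((\<lambda>\<omega>. W t \<omega> - W s \<omega>) -` C \<inter> space M))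
       = prob a * prob ((\<lambda>\<omega>. W t \<omega> - W s \<omega>) -` C \<inter> space M)"
proof -
  let ?n = "2 ^ m :: nat"
  define \<tau> where "\<tau> i = (if i \<le> ?n then s * (real i / 2 ^ m) else t)" for i
  define D where "D i \<omega> = W (\<tau> (Suc i)) \<omega> - W (\<tau> i) \<omega>" for i \<omega>
  define G where "G \<omega> = restrict (\<lambda>i. D i \<omega>) {..<?n}" for \<omega>
  have mono: "strict_mono_on {..Suc ?n} \<tau>"
  proof (rule strict_mono_onI)
    fix i j :: nat assume ij: "i \<in> {..Suc ?n}" "j \<in> {..Suc ?n}" "i < j"
    then have i: "i \<le> ?n" by simp
    then have "real i \<le> 2 ^ m" by (metis of_nat_le_iff of_nat_numeral of_nat_power)
    then have "s * (real i / 2 ^ m) \<le> s" using s by (intro mult_left_le) auto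
    then show "\<tau> i < \<tau> j" using ij i s by (auto simp: \<tau>_def divide_strict_right_mono)
  qed
  have "indep_vars (\<lambda>_. borel) (\<lambda>i \<omega>. B (\<tau> (Suc i)) \<omega> - B (\<tau> i) \<omega>) {..<Suc ?n}"
    by (rule independent_increments[OF _ mono]) (simp add: \<tau>_def)
  then have ind: "indep_vars (\<lambda>_. borel) D {..<Suc ?n}"
    by (simp add: D_def[abs_def] W_def)
  have iv: "indep_var (PiM {..<?n} (\<lambda>_. borel)) G (PiM {?n} (\<lambda>_. borel)) (\<lambda>\<omega>. \<lambda>i\<in>{?n}. D i \<omega>)"
    unfolding G_def[abs_def] by (rule indep_var_restrict[OF ind]) auto
  have Dn: "D ?n \<omega> = W t \<omega> - W s \<omega>" for \<omega>
    by (simp add: D_def \<tau>_def)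
  define N where "N = vimage_algebra (space M) G (PiM {..<?n} (\<lambda>_. borel :: real measure))"
  have G_meas: "G \<in> measurable M (PiM {..<?n} (\<lambda>_. borel))"
    using iv by (rule indep_var_rv1)
  have [simp]: "space N = space M" by (simp add: N_def)
  have sN: "sets N = {G -` A \<inter> space M |A. A \<in> sets (PiM {..<?n} (\<lambda>_. borel))}"
    unfolding N_def by (rule sets_vimage_algebra2) (use measurable_space[OF G_meas] in auto)
  have GN: "G \<in> measurable N (PiM {..<?n} (\<lambda>_. borel))"
    unfolding N_def by (rule measurable_vimage_algebra1) (use measurable_space[OF G_meas] in auto)
  have DN: "D i \<in> borel_measurable N" if "i < ?n" for i
  proof -
    have "(\<lambda>\<omega>. G \<omega> i) \<in> borel_measurable N"
      by (rule measurable_compose[OF GN measurable_component_singleton]) (use that in simp)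
    moreover have "(\<lambda>\<omega>. G \<omega> i) = D i" using that by (auto simp: G_def)
    ultimately show ?thesis by simp
  qed
  have WN: "W (s * (real j / 2 ^ m)) \<in> borel_measurable N" if j: "j \<le> ?n" for j
  proof -
    have "W (s * (real j / 2 ^ m)) \<omega> = (\<Sum>i<j. D i \<omega>)" for \<omega>
      using sum_lessThan_telescope[of "\<lambda>i. W (\<tau> i) \<omega>" j] j by (simp add: D_def \<tau>_def)
    then have "W (s * (real j / 2 ^ m)) = (\<lambda>\<omega>. \<Sum>i<j. D i \<omega>)" by blast
    then show ?thesis using DN j by (auto intro!: borel_measurable_sum)
  qed
  have "past_grid s m \<subseteq> sets N"
    unfolding past_grid_def
  proof (rule sigma_algebra.sigma_sets_subset)
    show "sigma_algebra (space M) (sets N)"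
      using sets.sigma_algebra_axioms[of N] by simp
    show "(\<Union>j\<in>{..2 ^ m}. {W (s * (real j / 2 ^ m)) -` A \<inter> space M |A. A \<in> sets borel}) \<subseteq> sets N"
      using measurable_sets[OF WN] by auto
  qed
  with a obtain A where A: "A \<in> sets (PiM {..<?n} (\<lambda>_. borel))" "a = G -` A \<inter> space M"
    unfolding sN by auto
  define C' where "C' = (\<lambda>x. x ?n) -` C \<inter> space (PiM {?n} (\<lambda>_. borel :: real measure))"
  have C': "C' \<in> sets (PiM {?n} (\<lambda>_. borel))"
    unfolding C'_def by (rule measurable_sets[OF _ C]) (rule measurable_component_singleton, simp)
  have pre: "(\<lambda>\<omega>. \<lambda>i\<in>{?n}. D i \<omega>) -` C' \<inter> space M = (\<lambda>\<omega>. W t \<omega> - W s \<omega>) -` C \<inter> space M"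
    by (auto simp: C'_def Dn space_PiM PiE_def)
  have "prob ((\<lambda>\<omega>. (G \<omega>, \<lambda>i\<in>{?n}. D i \<omega>)) -` (A \<times> C') \<inter> space M)
      = prob (G -` A \<inter> space M) * prob ((\<lambda>\<omega>. \<lambda>i\<in>{?n}. D i \<omega>) -` C' \<inter> space M)"
    by (rule indep_varD[OF iv A(1) C'])
  moreover have "(\<lambda>\<omega>. (G \<omega>, \<lambda>i\<in>{?n}. D i \<omega>)) -` (A \<times> C') \<inter> space M
      = (G -` A \<inter> space M) \<inter> ((\<lambda>\<omega>. \<lambda>i\<in>{?n}. D i \<omega>) -` C' \<inter> space M)"
    by auto
  ultimately show ?thesis unfolding pre A(2) by simp
qed

lemma sets_past_0: "sets (past 0) \<subseteq> {{}, space M}"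
proof -
  have "sigma_algebra (space M) {{}, space M}"
    by (rule sigma_algebra_trivial)
  moreover have "(\<Union>u\<in>{0..0}. {W u -` A \<inter> space M |A. A \<in> sets borel}) \<subseteq> {{}, space M}"
    by auto
  ultimately show ?thesis
    unfolding sets_past by (rule sigma_algebra.sigma_sets_subset)
qed

text \<open>Independence passes from the grid events to the sigma-algebra that they generate. At \<open>s = 0\<close> the
  grids degenerate to one point, but there the past is trivial.\<close>

lemma past_indep_increment:
  assumes s: "0 \<le> s" "s < t" and G: "G \<in> borel_measurable (past s)"
  shows "indep_var borel G borel (\<lambda>\<omega>. W t \<omega> - W s \<omega>)"
proof -
  let ?D = "\<lambda>\<omega>. W t \<omega> - W s \<omega>"
  have D: "?D \<in> borel_measurable M" using s by (intro borel_measurable_diff measurable_W) auto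
  define \<D> where "\<D> = {?D -` C \<inter> space M |C. C \<in> sets borel}"
  have ev: "\<D> \<subseteq> events" using measurable_sets[OF D] by (auto simp: \<D>_def)
  have "indep_set (sets (past s)) (sigma_sets (space M) \<D>)"
  proof (cases "s = 0")
    case True
    have "indep_set {{}, space M} (sigma_sets (space M) \<D>)"
      unfolding indep_sets2_eq
    proof (intro conjI ballI)
      show sub: "sigma_sets (space M) \<D> \<subseteq> events" by (rule sets.sigma_sets_subset[OF ev])
      fix a b assume "a \<in> {{}, space M}" and b: "b \<in> sigma_sets (space M) \<D>"
      moreover have "b \<subseteq> space M" using sub b sets.sets_into_space by blast
      ultimately show "prob (a \<inter> b) = prob a * prob b"
        by (auto simp: prob_space Int_absorb1)
    qed auto
    then show ?thesis
      using sets_past_0 True unfolding indep_sets2_eq by blast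
  next
    case False
    with s have s0: "0 < s" by simp
    have "indep_set (\<Union>m. past_grid s m) \<D>"
      unfolding indep_sets2_eq
      using past_grid_subset[OF s(1)] ev past_grid_indep_increment[OF s0 s(2)]
      by (auto simp: \<D>_def)
    moreover have "Int_stable (\<Union>m. past_grid s m)"
    proof (rule Int_stableI)
      fix a b assume "a \<in> (\<Union>m. past_grid s m)" "b \<in> (\<Union>m. past_grid s m)"
      then obtain m n where "a \<in> past_grid s m" "b \<in> past_grid s n" by blast
      then have ab: "a \<in> past_grid s (max m n)" "b \<in> past_grid s (max m n)"
        using past_grid_mono[of m "max m n" s] past_grid_mono[of n "max m n" s] by auto
      have "sigma_algebra (space M) (past_grid s (max m n))"
        unfolding past_grid_def by (rule sigma_algebra_sigma_sets) auto
      then interpret S: sigma_algebra "space M" "past_grid s (max m n)" .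
      show "a \<inter> b \<in> (\<Union>m. past_grid s m)" using S.Int[OF ab] by blast
    qed
    moreover have "Int_stable \<D>"
    proof (rule Int_stableI)
      fix a b assume "a \<in> \<D>" "b \<in> \<D>"
      then obtain A C where "A \<in> sets borel" "C \<in> sets borel"
        "a = ?D -` A \<inter> space M" "b = ?D -` C \<inter> space M" by (auto simp: \<D>_def)
      then show "a \<inter> b \<in> \<D>" unfolding \<D>_def by (intro CollectI exI[of _ "A \<inter> C"]) auto
    qed
    ultimately have "indep_set (sigma_sets (space M) (\<Union>m. past_grid s m)) (sigma_sets (space M) \<D>)"
      by (rule indep_set_sigma_sets)
    then show ?thesis
      using sets_past_subset_grid[OF s(1)] unfolding indep_sets2_eq by blast
  qed
  moreover have "sigma_sets (space M) {G -` A \<inter> space M |A. A \<in> sets borel} \<subseteq> sets (past s)"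
    using sets.sigma_sets_subset[of "{G -` A \<inter> space M |A. A \<in> sets borel}" "past s"]
      measurable_sets[OF G] by auto
  ultimately show ?thesis
    unfolding indep_var_eq indep_sets2_eq \<D>_def
    using D measurable_from_past[OF G] by blast
qed

end

section \<open>Optional sampling of the exponential martingale\<close>

text \<open>Rounding up, and not down, turns a stopping time into a stopping time on the grid.\<close>

definition grid_index :: "nat \<Rightarrow> real \<Rightarrow> nat" where
  "grid_index n r = nat \<lceil>r * 2 ^ n\<rceil>"

lemma grid_index_le_iff: "grid_index n r \<le> k \<longleftrightarrow> r \<le> real k / 2 ^ n"
proof -
  have "grid_index n r \<le> k \<longleftrightarrow> \<lceil>r * 2 ^ n\<rceil> \<le> int k" by (simp add: grid_index_def nat_le_iff)
  also have "\<dots> \<longleftrightarrow> r * 2 ^ n \<le> real k" by (simp add: ceiling_le_iff)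
  finally show ?thesis by (simp add: pos_le_divide_eq)
qed

lemma grid_index_tendsto:
  assumes "0 \<le> r"
  shows "(\<lambda>n. real (grid_index n r) * (1 / 2 ^ n)) \<longlonglongrightarrow> r"
proof -
  have "0 \<le> \<lceil>r * 2 ^ n\<rceil>" for n
  proof -
    have "0 \<le> r * 2 ^ n" using assms by simp
    then show ?thesis by linarith
  qed
  then show ?thesis using dyadic_ceiling_tendsto[of r] by (simp add: grid_index_def)
qed

context brownian_motion
begin

text \<open>Hitting times, weights and return times all come from processes of this kind.\<close>

definition continuous_adapted :: "(real \<Rightarrow> 'a \<Rightarrow> real) \<Rightarrow> bool" where
  "continuous_adapted Y \<longleftrightarrow> (\<forall>\<omega>\<in>space M. continuous_on {0..} (\<lambda>t. Y t \<omega>)) \<and>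
     (\<forall>s\<ge>0. Y s \<in> borel_measurable (past s))"

lemma continuous_adaptedD:
  assumes "continuous_adapted Y"
  shows "\<omega> \<in> space M \<Longrightarrow> continuous_on {0..} (\<lambda>t. Y t \<omega>)"
    and "0 \<le> s \<Longrightarrow> Y s \<in> borel_measurable (past s)"
  using assms by (auto simp: continuous_adapted_def)

lemma continuous_adapted_W: "continuous_adapted W"
  by (simp add: continuous_adapted_def continuous_W W_measurable_past)

lemma continuous_adapted_run_max:
  assumes Y: "continuous_adapted Y"
  shows "continuous_adapted (\<lambda>t \<omega>. run_max (\<lambda>s. Y s \<omega>) t)"
  unfolding continuous_adapted_def
proof (intro conjI ballI allI impI)
  show "(\<lambda>\<omega>. run_max (\<lambda>s. Y s \<omega>) t) \<in> borel_measurable (past t)" if "0 \<le> t" for t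
    by (rule run_max_measurable[OF _ that])
      (auto intro: continuous_adaptedD[OF Y] measurable_past_mono)
qed (rule continuous_on_run_max[OF continuous_adaptedD(1)[OF Y]])

lemma stopping_time_first_hit:
  assumes Y: "continuous_adapted Y" and t: "0 \<le> t"
  shows "stopping_time past (\<lambda>\<omega>. first_hit (\<lambda>u. Y u \<omega>) t)"
  by (rule stopping_timeI, rule first_hit_le_measurable[OF _ t])
    (auto intro: continuous_adaptedD[OF Y] measurable_past_mono)

definition exp_mart :: "real \<Rightarrow> real \<Rightarrow> 'a \<Rightarrow> real" where
  "exp_mart \<theta> t \<omega> = exp (\<theta> * W t \<omega> - \<theta>\<^sup>2 / 2 * t)"

lemma exp_mart_pos [simp]: "0 < exp_mart \<theta> t \<omega>" "0 \<le> exp_mart \<theta> t \<omega>"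
  by (simp_all add: exp_mart_def)

lemma exp_mart_0 [simp]: "exp_mart \<theta> 0 \<omega> = 1"
  by (simp add: exp_mart_def)

lemma exp_mart_measurable_past: "0 \<le> t \<Longrightarrow> exp_mart \<theta> t \<in> borel_measurable (past t)"
  using W_measurable_past[of t t] unfolding exp_mart_def[abs_def] by simp

lemma continuous_exp_mart: "\<omega> \<in> space M \<Longrightarrow> continuous_on {0..} (\<lambda>t. exp_mart \<theta> t \<omega>)"
  unfolding exp_mart_def by (intro continuous_intros continuous_W)

text \<open>The square is a deterministic factor times another exponential martingale. This bounds second
  moments at stopping times.\<close>

lemma exp_mart_square: "(exp_mart \<theta> t \<omega>)\<^sup>2 = exp (\<theta>\<^sup>2 * t) * exp_mart (2 * \<theta>) t \<omega>"
  by (simp add: exp_mart_def power2_eq_square algebra_simps flip: exp_add)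

lemma exp_increment:
  assumes s: "0 \<le> s" "s < t"
  shows "integrable M (\<lambda>\<omega>. exp (\<theta> * (W t \<omega> - W s \<omega>) - \<theta>\<^sup>2 / 2 * (t - s)))"
    and "(\<integral>\<omega>. exp (\<theta> * (W t \<omega> - W s \<omega>) - \<theta>\<^sup>2 / 2 * (t - s)) \<partial>M) = 1"
proof -
  have dist: "distributed M lborel (\<lambda>\<omega>. W t \<omega> - W s \<omega>) (normal_density 0 (sqrt (t - s)))"
    using normal_increments[OF s] by (simp add: W_def)
  note mom = normal_density_exp_moment[of "sqrt (t - s)" \<theta>]
  have i: "integrable M (\<lambda>\<omega>. exp (\<theta> * (W t \<omega> - W s \<omega>)))"
    using mom(1) s by (subst distributed_integrable[OF dist, symmetric]) auto
  have e: "(\<integral>\<omega>. exp (\<theta> * (W t \<omega> - W s \<omega>)) \<partial>M) = exp (\<theta>\<^sup>2 * (t - s) / 2)"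
    using mom(2) s by (subst distributed_integral[OF dist, symmetric]) auto
  have eq: "exp (\<theta> * (W t \<omega> - W s \<omega>) - \<theta>\<^sup>2 / 2 * (t - s))
      = exp (- (\<theta>\<^sup>2 * (t - s) / 2)) * exp (\<theta> * (W t \<omega> - W s \<omega>))" for \<omega>
    by (simp flip: exp_add)
  show "integrable M (\<lambda>\<omega>. exp (\<theta> * (W t \<omega> - W s \<omega>) - \<theta>\<^sup>2 / 2 * (t - s)))"
    unfolding eq using i by (rule integrable_mult_right)
  show "(\<integral>\<omega>. exp (\<theta> * (W t \<omega> - W s \<omega>) - \<theta>\<^sup>2 / 2 * (t - s)) \<partial>M) = 1"
    unfolding eq integral_mult_right_zero e by (simp flip: exp_add)
qed

lemma integrable_exp_mart: "0 \<le> t \<Longrightarrow> integrable M (exp_mart \<theta> t)"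
  using exp_increment(1)[of 0 t \<theta>] by (cases "t = 0") (simp_all add: exp_mart_def[abs_def])

text \<open>A weight known at time \<open>s\<close> is independent of the factor by which the martingale changes after
  \<open>s\<close>, and that factor has mean 1.\<close>

lemma exp_mart_increment:
  assumes s: "0 \<le> s" "s \<le> t"
    and G: "G \<in> borel_measurable (past s)" "\<And>\<omega>. \<omega> \<in> space M \<Longrightarrow> \<bar>G \<omega>\<bar> \<le> 1"
  shows "integrable M (\<lambda>\<omega>. G \<omega> * (exp_mart \<theta> t \<omega> - exp_mart \<theta> s \<omega>))"
    and "(\<integral>\<omega>. G \<omega> * (exp_mart \<theta> t \<omega> - exp_mart \<theta> s \<omega>) \<partial>M) = 0"
proof -
  have bounded: "integrable M (\<lambda>\<omega>. G \<omega> * exp_mart \<theta> u \<omega>)" if "0 \<le> u" for u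
  proof (rule Bochner_Integration.integrable_bound[OF integrable_exp_mart[OF that, of \<theta>]])
    show "(\<lambda>\<omega>. G \<omega> * exp_mart \<theta> u \<omega>) \<in> borel_measurable M"
      using measurable_from_past[OF G(1)] measurable_from_past[OF exp_mart_measurable_past[OF that]]
      by simp
    show "AE \<omega> in M. norm (G \<omega> * exp_mart \<theta> u \<omega>) \<le> norm (exp_mart \<theta> u \<omega>)"
      using G(2) by (auto intro!: AE_I2 mult_left_le_one_le simp: abs_mult)
  qed
  show "integrable M (\<lambda>\<omega>. G \<omega> * (exp_mart \<theta> t \<omega> - exp_mart \<theta> s \<omega>))"
    using bounded[of t] bounded[of s] s by (simp add: right_diff_distrib)
  show "(\<integral>\<omega>. G \<omega> * (exp_mart \<theta> t \<omega> - exp_mart \<theta> s \<omega>) \<partial>M) = 0"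
  proof (cases "s = t")
    case False
    with s have st: "s < t" by simp
    let ?X = "\<lambda>\<omega>. G \<omega> * exp_mart \<theta> s \<omega>"
    let ?f = "\<lambda>x. exp (\<theta> * x - \<theta>\<^sup>2 / 2 * (t - s))"
    let ?Y = "\<lambda>\<omega>. ?f (W t \<omega> - W s \<omega>)"
    have X: "?X \<in> borel_measurable (past s)"
      using G(1) exp_mart_measurable_past[OF s(1)] by simp
    have "indep_var borel ((\<lambda>x. x) \<circ> ?X) borel (?f \<circ> (\<lambda>\<omega>. W t \<omega> - W s \<omega>))"
      by (rule indep_var_compose[OF past_indep_increment[OF s(1) st X]]) simp_all
    then have "indep_var borel ?X borel ?Y" by (simp add: comp_def)
    from indep_var_lebesgue_integral[OF this bounded[OF s(1)] exp_increment(1)[OF s(1) st, of \<theta>]]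
    have mean: "(\<integral>\<omega>. ?X \<omega> * ?Y \<omega> \<partial>M) = (\<integral>\<omega>. ?X \<omega> \<partial>M)"
      unfolding exp_increment(2)[OF s(1) st] by simp
    have XY: "?X \<omega> * ?Y \<omega> = G \<omega> * exp_mart \<theta> t \<omega>" for \<omega>
    proof -
      have "\<theta> * W s \<omega> - \<theta>\<^sup>2 / 2 * s + (\<theta> * (W t \<omega> - W s \<omega>) - \<theta>\<^sup>2 / 2 * (t - s))
          = \<theta> * W t \<omega> - \<theta>\<^sup>2 / 2 * t"
        by (simp add: field_simps)
      then show ?thesis by (simp add: exp_mart_def mult.assoc flip: exp_add)
    qed
    show ?thesis
      using mean[unfolded XY] bounded[of t] bounded[of s] s by (simp add: right_diff_distrib)
  qed simp
qed

text \<open>The difference of the two sides telescopes into a sum over \<open>k\<close> of martingale increments, each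
  with the weight \<open>Z J\<close> on the event \<open>J \<le> k < K\<close>. This weight is known at time \<open>k * h\<close>, since on
  \<open>J \<le> k\<close> it is a finite combination of the \<open>Z j\<close> with \<open>j \<le> k\<close>.\<close>

lemma discrete_optional_sampling:
  fixes J K :: "'a \<Rightarrow> nat" and Z :: "nat \<Rightarrow> 'a \<Rightarrow> real"
  assumes h: "0 \<le> h"
    and J: "\<And>k. Measurable.pred (past (real k * h)) (\<lambda>\<omega>. J \<omega> \<le> k)"
    and K: "\<And>k. Measurable.pred (past (real k * h)) (\<lambda>\<omega>. K \<omega> \<le> k)"
    and Z: "\<And>k. Z k \<in> borel_measurable (past (real k * h))"
      "\<And>k \<omega>. \<omega> \<in> space M \<Longrightarrow> \<bar>Z k \<omega>\<bar> \<le> 1"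
    and JK: "\<And>\<omega>. \<omega> \<in> space M \<Longrightarrow> J \<omega> \<le> K \<omega>" "\<And>\<omega>. \<omega> \<in> space M \<Longrightarrow> K \<omega> \<le> N"
  shows "integrable M (\<lambda>\<omega>. Z (J \<omega>) \<omega> * exp_mart \<theta> (real (K \<omega>) * h) \<omega>)"
    and "integrable M (\<lambda>\<omega>. Z (J \<omega>) \<omega> * exp_mart \<theta> (real (J \<omega>) * h) \<omega>)"
    and "(\<integral>\<omega>. Z (J \<omega>) \<omega> * exp_mart \<theta> (real (K \<omega>) * h) \<omega> \<partial>M)
       = (\<integral>\<omega>. Z (J \<omega>) \<omega> * exp_mart \<theta> (real (J \<omega>) * h) \<omega> \<partial>M)"
proof -
  let ?V = "\<lambda>k. exp_mart \<theta> (real k * h)"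
  have kh: "0 \<le> real k * h" for k using h by simp
  have past_mono: "f \<in> measurable (past (real k * h)) S \<Longrightarrow> k \<le> l \<Longrightarrow> f \<in> measurable (past (real l * h)) S"
    for f :: "'a \<Rightarrow> 'b" and S k l
    by (erule measurable_past_mono) (simp add: h mult_right_mono)
  have Jeq: "Measurable.pred (past (real k * h)) (\<lambda>\<omega>. J \<omega> = j)" if "j \<le> k" for j k
  proof (cases j)
    case 0
    have "Measurable.pred (past (real k * h)) (\<lambda>\<omega>. J \<omega> \<le> 0)" by (rule past_mono[OF J]) simp
    then show ?thesis using 0 by simp
  next
    case (Suc i)
    have [measurable]: "Measurable.pred (past (real k * h)) (\<lambda>\<omega>. J \<omega> \<le> i)"
      "Measurable.pred (past (real k * h)) (\<lambda>\<omega>. J \<omega> \<le> j)"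
      using Suc that by (auto intro!: past_mono[OF J])
    have "Measurable.pred (past (real k * h)) (\<lambda>\<omega>. J \<omega> \<le> j \<and> \<not> J \<omega> \<le> i)" by measurable
    moreover have "(\<lambda>\<omega>. J \<omega> \<le> j \<and> \<not> J \<omega> \<le> i) = (\<lambda>\<omega>. J \<omega> = j)" using Suc by auto
    ultimately show ?thesis by simp
  qed
  define G where "G k \<omega> = (if J \<omega> \<le> k \<and> \<not> K \<omega> \<le> k then Z (J \<omega>) \<omega> else 0)" for k \<omega>
  have G: "G k \<in> borel_measurable (past (real k * h))" for k
  proof -
    have [measurable]: "Measurable.pred (past (real k * h)) (\<lambda>\<omega>. K \<omega> \<le> k)" by (rule K)
    have "(\<lambda>\<omega>. \<Sum>j\<le>k. if J \<omega> = j then Z j \<omega> else 0) \<in> borel_measurable (past (real k * h))"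
    proof (rule borel_measurable_sum)
      fix j assume "j \<in> {..k}"
      then have [measurable]: "Measurable.pred (past (real k * h)) (\<lambda>\<omega>. J \<omega> = j)"
        "Z j \<in> borel_measurable (past (real k * h))"
        by (auto intro!: Jeq past_mono[OF Z(1)])
      show "(\<lambda>\<omega>. if J \<omega> = j then Z j \<omega> else 0) \<in> borel_measurable (past (real k * h))"
        by measurable
    qed
    then have "(\<lambda>\<omega>. if K \<omega> \<le> k then 0 else \<Sum>j\<le>k. if J \<omega> = j then Z j \<omega> else 0)
        \<in> borel_measurable (past (real k * h))" by measurable
    moreover have "G k = (\<lambda>\<omega>. if K \<omega> \<le> k then 0 else \<Sum>j\<le>k. if J \<omega> = j then Z j \<omega> else 0)"
      by (auto simp: G_def fun_eq_iff)
    ultimately show ?thesis by simp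
  qed
  have G1: "\<bar>G k \<omega>\<bar> \<le> 1" if "\<omega> \<in> space M" for k \<omega>
    using Z(2)[OF that] by (simp add: G_def)
  have telescope: "Z (J \<omega>) \<omega> * ?V (K \<omega>) \<omega> - Z (J \<omega>) \<omega> * ?V (J \<omega>) \<omega>
      = (\<Sum>k<N. G k \<omega> * (?V (Suc k) \<omega> - ?V k \<omega>))" if \<omega>: "\<omega> \<in> space M" for \<omega>
  proof -
    have "(\<Sum>k<N. G k \<omega> * (?V (Suc k) \<omega> - ?V k \<omega>))
        = (\<Sum>k\<in>{J \<omega>..<K \<omega>}. Z (J \<omega>) \<omega> * (?V (Suc k) \<omega> - ?V k \<omega>))"
      by (rule sum.mono_neutral_cong_right) (use JK[OF \<omega>] in \<open>auto simp: G_def\<close>)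
    also have "\<dots> = Z (J \<omega>) \<omega> * (\<Sum>k\<in>{J \<omega>..<K \<omega>}. ?V (Suc k) \<omega> - ?V k \<omega>)"
      by (simp only: sum_distrib_left)
    also have "\<dots> = Z (J \<omega>) \<omega> * (?V (K \<omega>) \<omega> - ?V (J \<omega>) \<omega>)"
      by (subst sum_Suc_diff'[OF JK(1)[OF \<omega>], of "\<lambda>k. ?V k \<omega>"]) (rule refl)
    finally show ?thesis by (simp add: right_diff_distrib)
  qed
  have inc: "integrable M (\<lambda>\<omega>. G k \<omega> * (?V (Suc k) \<omega> - ?V k \<omega>))"
    "(\<integral>\<omega>. G k \<omega> * (?V (Suc k) \<omega> - ?V k \<omega>) \<partial>M) = 0" for k
    using exp_mart_increment[OF kh _ G G1, of k "real (Suc k) * h" \<theta>] h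
    by (simp_all add: mult_right_mono)
  show iJ: "integrable M (\<lambda>\<omega>. Z (J \<omega>) \<omega> * ?V (J \<omega>) \<omega>)"
  proof -
    have iZ: "integrable M (\<lambda>\<omega>. (if J \<omega> = j then Z j \<omega> else 0) * ?V j \<omega>)" for j
    proof (rule Bochner_Integration.integrable_bound[OF integrable_exp_mart[OF kh, of \<theta> j]])
      have [measurable]: "Measurable.pred M (\<lambda>\<omega>. J \<omega> = j)" "Z j \<in> borel_measurable M"
        "?V j \<in> borel_measurable M"
        using measurable_from_past[OF Jeq[OF order_refl]] measurable_from_past[OF Z(1)]
          measurable_from_past[OF exp_mart_measurable_past[OF kh]] by auto
      show "(\<lambda>\<omega>. (if J \<omega> = j then Z j \<omega> else 0) * ?V j \<omega>) \<in> borel_measurable M" by measurable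
      show "AE \<omega> in M. norm ((if J \<omega> = j then Z j \<omega> else 0) * ?V j \<omega>) \<le> norm (?V j \<omega>)"
        using Z(2) by (auto intro!: AE_I2 mult_left_le_one_le simp: abs_mult)
    qed
    have "integrable M (\<lambda>\<omega>. \<Sum>j\<le>N. (if J \<omega> = j then Z j \<omega> else 0) * ?V j \<omega>)"
      by (rule Bochner_Integration.integrable_sum) (rule iZ)
    moreover have "(\<Sum>j\<le>N. (if J \<omega> = j then Z j \<omega> else 0) * ?V j \<omega>) = Z (J \<omega>) \<omega> * ?V (J \<omega>) \<omega>"
      if "\<omega> \<in> space M" for \<omega>
    proof -
      have "(\<Sum>j\<le>N. (if J \<omega> = j then Z j \<omega> else 0) * ?V j \<omega>)
          = (\<Sum>j\<le>N. if J \<omega> = j then Z j \<omega> * ?V j \<omega> else 0)"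
        by (rule sum.cong) auto
      then show ?thesis using JK[OF that] by simp
    qed
    ultimately show ?thesis by (simp cong: Bochner_Integration.integrable_cong)
  qed
  have iS: "integrable M (\<lambda>\<omega>. \<Sum>k<N. G k \<omega> * (?V (Suc k) \<omega> - ?V k \<omega>))"
    by (rule Bochner_Integration.integrable_sum) (rule inc)
  have split: "Z (J \<omega>) \<omega> * ?V (K \<omega>) \<omega> =
      Z (J \<omega>) \<omega> * ?V (J \<omega>) \<omega> + (\<Sum>k<N. G k \<omega> * (?V (Suc k) \<omega> - ?V k \<omega>))" if "\<omega> \<in> space M" for \<omega>
    using telescope[OF that] by simp
  show "integrable M (\<lambda>\<omega>. Z (J \<omega>) \<omega> * ?V (K \<omega>) \<omega>)"
    using Bochner_Integration.integrable_add[OF iJ iS]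
    by (subst Bochner_Integration.integrable_cong[OF refl split])
  have "(\<integral>\<omega>. Z (J \<omega>) \<omega> * ?V (K \<omega>) \<omega> \<partial>M)
      = (\<integral>\<omega>. Z (J \<omega>) \<omega> * ?V (J \<omega>) \<omega> \<partial>M)
        + (\<integral>\<omega>. (\<Sum>k<N. G k \<omega> * (?V (Suc k) \<omega> - ?V k \<omega>)) \<partial>M)"
    using Bochner_Integration.integral_add[OF iJ iS]
    by (subst Bochner_Integration.integral_cong[OF refl split])
  also have "(\<integral>\<omega>. (\<Sum>k<N. G k \<omega> * (?V (Suc k) \<omega> - ?V k \<omega>)) \<partial>M) = 0"
    by (subst Bochner_Integration.integral_sum[OF inc(1)]) (simp only: inc(2) sum.neutral_const)
  finally show "(\<integral>\<omega>. Z (J \<omega>) \<omega> * ?V (K \<omega>) \<omega> \<partial>M) = (\<integral>\<omega>. Z (J \<omega>) \<omega> * ?V (J \<omega>) \<omega> \<partial>M)"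
    by simp
qed

text \<open>Optional sampling between two stopping times with a weight \<open>z \<tau>\<close> that is known at \<open>\<tau>\<close>. Evaluating
  \<open>z\<close> along the same rounded times as the martingale keeps the weight adapted at every stage of the
  approximation.\<close>

lemma optional_sampling:
  assumes z: "continuous_adapted z" "\<And>t \<omega>. 0 \<le> t \<Longrightarrow> \<omega> \<in> space M \<Longrightarrow> 0 \<le> z t \<omega> \<and> z t \<omega> \<le> 1"
    and st: "stopping_time past \<tau>" "stopping_time past \<rho>"
    and ord: "\<And>\<omega>. \<omega> \<in> space M \<Longrightarrow> 0 \<le> \<tau> \<omega> \<and> \<tau> \<omega> \<le> \<rho> \<omega> \<and> \<rho> \<omega> \<le> real N"
  shows "(\<lambda>\<omega>. z (\<tau> \<omega>) \<omega> * exp_mart \<theta> (\<rho> \<omega>) \<omega>) \<in> borel_measurable M"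
    and "(\<integral>\<omega>. z (\<tau> \<omega>) \<omega> * exp_mart \<theta> (\<rho> \<omega>) \<omega> \<partial>M) = (\<integral>\<omega>. z (\<tau> \<omega>) \<omega> * exp_mart \<theta> (\<tau> \<omega>) \<omega> \<partial>M)"
proof -
  define d :: "nat \<Rightarrow> nat \<Rightarrow> real" where "d n k = real k * (1 / 2 ^ n)" for n k
  define J where "J n \<omega> = grid_index n (\<tau> \<omega>)" for n \<omega>
  define K where "K n \<omega> = grid_index n (\<rho> \<omega>)" for n \<omega>
  define P where "P n \<omega> = z (d n (J n \<omega>)) \<omega> * exp_mart \<theta> (d n (K n \<omega>)) \<omega>" for n \<omega>
  define Q where "Q n \<omega> = z (d n (J n \<omega>)) \<omega> * exp_mart \<theta> (d n (J n \<omega>)) \<omega>" for n \<omega>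
  have d0: "0 \<le> d n k" for n k by (simp add: d_def)
  have Jp: "Measurable.pred (past (real k * (1 / 2 ^ n))) (\<lambda>\<omega>. J n \<omega> \<le> k)" for n k
    unfolding J_def grid_index_le_iff using stopping_timeD[OF st(1), of "real k / 2 ^ n"] by simp
  have Kp: "Measurable.pred (past (real k * (1 / 2 ^ n))) (\<lambda>\<omega>. K n \<omega> \<le> k)" for n k
    unfolding K_def grid_index_le_iff using stopping_timeD[OF st(2), of "real k / 2 ^ n"] by simp
  have JK: "J n \<omega> \<le> K n \<omega>" if "\<omega> \<in> space M" for n \<omega>
  proof -
    have "\<rho> \<omega> \<le> real (K n \<omega>) / 2 ^ n" using grid_index_le_iff[of n "\<rho> \<omega>" "K n \<omega>"] by (simp add: K_def)
    with ord[OF that] show ?thesis unfolding J_def grid_index_le_iff by linarith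
  qed
  have KN: "K n \<omega> \<le> N * 2 ^ n" if "\<omega> \<in> space M" for n \<omega>
    using ord[OF that] by (simp add: K_def grid_index_le_iff)
  have zd: "z (d n k) \<in> borel_measurable (past (real k * (1 / 2 ^ n)))" for n k
    using continuous_adaptedD(2)[OF z(1) d0[of n k]] by (simp add: d_def)
  have zle: "\<bar>z (d n k) \<omega>\<bar> \<le> 1" if "\<omega> \<in> space M" for n k \<omega>
    using z(2)[OF d0[of n k] that] by simp
  have disc: "integrable M (\<lambda>\<omega>. z (d n (J n \<omega>)) \<omega> * exp_mart \<eta> (d n (K n \<omega>)) \<omega>)"
      "integrable M (\<lambda>\<omega>. z (d n (J n \<omega>)) \<omega> * exp_mart \<eta> (d n (J n \<omega>)) \<omega>)"
      "(\<integral>\<omega>. z (d n (J n \<omega>)) \<omega> * exp_mart \<eta> (d n (K n \<omega>)) \<omega> \<partial>M)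
       = (\<integral>\<omega>. z (d n (J n \<omega>)) \<omega> * exp_mart \<eta> (d n (J n \<omega>)) \<omega> \<partial>M)" for n \<eta>
    using discrete_optional_sampling[where h = "1 / 2 ^ n" and J = "J n" and K = "K n"
        and Z = "\<lambda>k. z (d n k)" and N = "N * 2 ^ n" and \<theta> = \<eta>, OF _ Jp Kp zd zle JK KN]
    by (simp_all add: d_def)
  have one: "integrable M (\<lambda>\<omega>. exp_mart \<eta> (d n (L \<omega>)) \<omega>)"
      "(\<integral>\<omega>. exp_mart \<eta> (d n (L \<omega>)) \<omega> \<partial>M) = 1"
    if L: "\<And>k. Measurable.pred (past (real k * (1 / 2 ^ n))) (\<lambda>\<omega>. L \<omega> \<le> k)"
      "\<And>\<omega>. \<omega> \<in> space M \<Longrightarrow> L \<omega> \<le> N * 2 ^ n" for n \<eta> and L :: "'a \<Rightarrow> nat"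
    using discrete_optional_sampling[where h = "1 / 2 ^ n" and J = "\<lambda>_. 0" and K = L
        and Z = "\<lambda>k \<omega>. 1" and N = "N * 2 ^ n" and \<theta> = \<eta>, OF _ _ L(1) _ _ _ L(2)]
    by (simp_all add: d_def prob_space)
  have second_moment: "integrable M (\<lambda>\<omega>. (z (d n (J n \<omega>)) \<omega> * exp_mart \<theta> (d n (L \<omega>)) \<omega>)\<^sup>2) \<and>
      (\<integral>\<omega>. (z (d n (J n \<omega>)) \<omega> * exp_mart \<theta> (d n (L \<omega>)) \<omega>)\<^sup>2 \<partial>M) \<le> exp (\<theta>\<^sup>2 * real N)"
    if L: "\<And>k. Measurable.pred (past (real k * (1 / 2 ^ n))) (\<lambda>\<omega>. L \<omega> \<le> k)"
      "\<And>\<omega>. \<omega> \<in> space M \<Longrightarrow> L \<omega> \<le> N * 2 ^ n"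
      and m: "(\<lambda>\<omega>. z (d n (J n \<omega>)) \<omega> * exp_mart \<theta> (d n (L \<omega>)) \<omega>) \<in> borel_measurable M"
    for n and L :: "'a \<Rightarrow> nat"
  proof -
    have pt: "(z (d n (J n \<omega>)) \<omega> * exp_mart \<theta> (d n (L \<omega>)) \<omega>)\<^sup>2
        \<le> exp (\<theta>\<^sup>2 * real N) * exp_mart (2 * \<theta>) (d n (L \<omega>)) \<omega>" if "\<omega> \<in> space M" for \<omega>
    proof -
      have "(z (d n (J n \<omega>)) \<omega>)\<^sup>2 \<le> 1" using zle[OF that, of n "J n \<omega>"] by (simp add: abs_square_le_1)
      then have "(z (d n (J n \<omega>)) \<omega> * exp_mart \<theta> (d n (L \<omega>)) \<omega>)\<^sup>2 \<le> (exp_mart \<theta> (d n (L \<omega>)) \<omega>)\<^sup>2"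
        unfolding power_mult_distrib by (intro mult_left_le_one_le) auto
      also have "\<dots> = exp (\<theta>\<^sup>2 * d n (L \<omega>)) * exp_mart (2 * \<theta>) (d n (L \<omega>)) \<omega>"
        by (rule exp_mart_square)
      also have "\<dots> \<le> exp (\<theta>\<^sup>2 * real N) * exp_mart (2 * \<theta>) (d n (L \<omega>)) \<omega>"
      proof -
        have "real (L \<omega>) \<le> real N * 2 ^ n" using L(2)[OF that] by (metis of_nat_le_iff of_nat_mult of_nat_numeral of_nat_power)
        then have "d n (L \<omega>) \<le> real N" by (simp add: d_def field_simps)
        then show ?thesis by (intro mult_right_mono) (auto intro: mult_left_mono)
      qed
      finally show ?thesis .
    qed
    have i: "integrable M (\<lambda>\<omega>. exp (\<theta>\<^sup>2 * real N) * exp_mart (2 * \<theta>) (d n (L \<omega>)) \<omega>)"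
      using one(1)[OF L] by simp
    have i2: "integrable M (\<lambda>\<omega>. (z (d n (J n \<omega>)) \<omega> * exp_mart \<theta> (d n (L \<omega>)) \<omega>)\<^sup>2)"
      by (rule Bochner_Integration.integrable_bound[OF i])
        (use m pt in \<open>auto intro!: AE_I2 borel_measurable_power\<close>)
    have "(\<integral>\<omega>. (z (d n (J n \<omega>)) \<omega> * exp_mart \<theta> (d n (L \<omega>)) \<omega>)\<^sup>2 \<partial>M)
        \<le> (\<integral>\<omega>. exp (\<theta>\<^sup>2 * real N) * exp_mart (2 * \<theta>) (d n (L \<omega>)) \<omega> \<partial>M)"
      by (rule integral_mono[OF i2 i pt])
    also have "\<dots> = exp (\<theta>\<^sup>2 * real N)" using one(2)[OF L] by simp
    finally show ?thesis using i2 by blast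
  qed
  have lim\<tau>: "(\<lambda>n. d n (J n \<omega>)) \<longlonglongrightarrow> \<tau> \<omega>" and lim\<rho>: "(\<lambda>n. d n (K n \<omega>)) \<longlonglongrightarrow> \<rho> \<omega>"
    if "\<omega> \<in> space M" for \<omega>
    using ord[OF that] grid_index_tendsto[of "\<tau> \<omega>"] grid_index_tendsto[of "\<rho> \<omega>"]
    unfolding d_def J_def K_def by auto
  have comp: "(\<lambda>n. f (s n)) \<longlonglongrightarrow> f r"
    if "continuous_on {0..} f" "s \<longlonglongrightarrow> r" "0 \<le> r" "\<And>n. 0 \<le> s n" for f :: "real \<Rightarrow> real" and s r
    by (rule continuous_on_tendsto_compose[OF that(1,2)]) (use that in auto)
  have limP: "(\<lambda>n. P n \<omega>) \<longlonglongrightarrow> z (\<tau> \<omega>) \<omega> * exp_mart \<theta> (\<rho> \<omega>) \<omega>"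
   and limQ: "(\<lambda>n. Q n \<omega>) \<longlonglongrightarrow> z (\<tau> \<omega>) \<omega> * exp_mart \<theta> (\<tau> \<omega>) \<omega>" if \<omega>: "\<omega> \<in> space M" for \<omega>
    unfolding P_def Q_def using ord[OF \<omega>]
    by (auto intro!: tendsto_mult comp[OF continuous_adaptedD(1)[OF z(1) \<omega>] lim\<tau>[OF \<omega>]]
      comp[OF continuous_exp_mart[OF \<omega>] lim\<tau>[OF \<omega>]] comp[OF continuous_exp_mart[OF \<omega>] lim\<rho>[OF \<omega>]] d0)
  have P: "P n \<in> borel_measurable M" and Q: "Q n \<in> borel_measurable M" for n
    using disc(1,2)[of n \<theta>] unfolding P_def[abs_def] Q_def[abs_def] by auto
  show "(\<lambda>\<omega>. z (\<tau> \<omega>) \<omega> * exp_mart \<theta> (\<rho> \<omega>) \<omega>) \<in> borel_measurable M"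
    by (rule borel_measurable_LIMSEQ_real[OF limP P])
  have JN: "J n \<omega> \<le> N * 2 ^ n" if "\<omega> \<in> space M" for n \<omega>
    using JK[OF that, of n] KN[OF that, of n] by simp
  have P0: "0 \<le> P n \<omega>" and Q0: "0 \<le> Q n \<omega>" if "\<omega> \<in> space M" for n \<omega>
    unfolding P_def Q_def using z(2)[OF d0 that] by simp_all
  have "(\<lambda>n. \<integral>\<omega>. P n \<omega> \<partial>M) \<longlonglongrightarrow> (\<integral>\<omega>. z (\<tau> \<omega>) \<omega> * exp_mart \<theta> (\<rho> \<omega>) \<omega> \<partial>M)"
    using second_moment[OF Kp KN] P
    by (intro expectation_tendsto_of_bounded_second_moment[OF P P0 _ _ limP, where C = "exp (\<theta>\<^sup>2 * real N)"])
      (auto simp: P_def[abs_def])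
  moreover have "(\<lambda>n. \<integral>\<omega>. Q n \<omega> \<partial>M) \<longlonglongrightarrow> (\<integral>\<omega>. z (\<tau> \<omega>) \<omega> * exp_mart \<theta> (\<tau> \<omega>) \<omega> \<partial>M)"
    using second_moment[OF Jp JN] Q
    by (intro expectation_tendsto_of_bounded_second_moment[OF Q Q0 _ _ limQ, where C = "exp (\<theta>\<^sup>2 * real N)"])
      (auto simp: Q_def[abs_def])
  moreover have "(\<integral>\<omega>. P n \<omega> \<partial>M) = (\<integral>\<omega>. Q n \<omega> \<partial>M)" for n
    unfolding P_def Q_def by (rule disc(3))
  ultimately show "(\<integral>\<omega>. z (\<tau> \<omega>) \<omega> * exp_mart \<theta> (\<rho> \<omega>) \<omega> \<partial>M) = (\<integral>\<omega>. z (\<tau> \<omega>) \<omega> * exp_mart \<theta> (\<tau> \<omega>) \<omega> \<partial>M)"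
    by (simp add: LIMSEQ_unique)
qed

end

section \<open>Two integrals\<close>

lemma exp_minus_mult_tendsto_0:
  fixes c :: real
  assumes "0 < c"
  shows "((\<lambda>x. exp (- (c * x))) \<longlongrightarrow> 0) at_top"
proof -
  have "filterlim (\<lambda>x. c * x) at_top at_top"
    by (rule filterlim_tendsto_pos_mult_at_top[OF tendsto_const assms filterlim_ident])
  then show ?thesis
    by (intro filterlim_compose[OF exp_at_bot] filterlim_uminus_at_bot_at_top[THEN filterlim_compose])
qed

text \<open>The second claim holds because the antiderivative \<open>- exp (- c x) - sinh (c a) * ln (tanh (c (x + a) / 2))\<close>
  is nondecreasing and vanishes at infinity.\<close>

lemma exit_integral:
  fixes c a :: real
  assumes c: "0 < c" and a: "0 < a"
  shows "(\<integral>\<^sup>+x. ennreal (c * exp (- (c * (x + a))) * (sinh (c * x) / sinh (c * (x + a)))) * indicator {0..} x \<partial>lborel)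
     = ennreal (1 + sinh (c * a) * ln (tanh (c * a / 2)))"
    and "0 \<le> 1 + sinh (c * a) * ln (tanh (c * a / 2))"
proof -
  let ?G = "\<lambda>x. - exp (- (c * x)) - sinh (c * a) * ln (tanh (c * (x + a) / 2))"
  let ?g = "\<lambda>x. c * exp (- (c * (x + a))) * (sinh (c * x) / sinh (c * (x + a)))"
  have g_meas: "?g \<in> borel_measurable borel"
    unfolding sinh_def by measurable
  have g: "0 \<le> ?g x" "(?G has_real_derivative ?g x) (at x)" if x: "0 \<le> x" for x
  proof -
    have u: "0 < c * (x + a)" using c a x by simp
    then have pos: "0 < sinh (c * (x + a))" "0 < sinh (c * (x + a) / 2)" "0 < cosh (c * (x + a) / 2)"
      "0 < tanh (c * (x + a) / 2)" by simp_all
    show "0 \<le> ?g x" using c pos x by simp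
    have d: "(?G has_real_derivative (c * exp (- (c * x)) - sinh (c * a) * (c / sinh (c * (x + a))))) (at x)"
    proof -
      define s k where "s = sinh (c * (x + a) / 2)" and "k = cosh (c * (x + a) / 2)"
      have sk: "0 < s" "0 < k" "k\<^sup>2 = s\<^sup>2 + 1" "sinh (c * (x + a)) = 2 * s * k"
        "tanh (c * (x + a) / 2) = s / k"
        using pos cosh_square_eq[of "c * (x + a) / 2"] sinh_double[of "c * (x + a) / 2"]
        by (simp_all add: s_def k_def tanh_def)
      have eq: "(1 - (tanh (c * (x + a) / 2))\<^sup>2) * (c / 2) / tanh (c * (x + a) / 2) = c / sinh (c * (x + a))"
      proof -
        have s2: "s * s = k * k - 1" using sk(3) by (simp add: power2_eq_square)
        have "1 - (s / k)\<^sup>2 = 1 / (k * k)"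
          using sk(2) by (simp add: power_divide power2_eq_square s2 diff_divide_distrib)
        then show ?thesis unfolding sk(4,5) using sk(1,2) by simp
      qed
      show ?thesis
        unfolding eq[symmetric]
        by (auto intro!: derivative_eq_intros
            simp: pos(4) u less_imp_neq[OF pos(3), symmetric] mult_ac)
    qed
    moreover have "c * exp (- (c * x)) - sinh (c * a) * (c / sinh (c * (x + a))) = ?g x"
    proof -
      have "exp (- (c * x)) * sinh (c * (x + a)) - sinh (c * a) = exp (- (c * (x + a))) * sinh (c * x)"
        by (simp add: sinh_def algebra_simps flip: exp_add)
      then have "c * (exp (- (c * x)) * sinh (c * (x + a)) - sinh (c * a)) / sinh (c * (x + a))
          = c * (exp (- (c * (x + a))) * sinh (c * x)) / sinh (c * (x + a))" by simp
      then show ?thesis using pos(1) by (simp add: field_simps)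
    qed
    ultimately show "(?G has_real_derivative ?g x) (at x)" by simp
  qed
  have G: "(?G \<longlongrightarrow> 0) at_top"
  proof -
    have "((\<lambda>x. tanh (c * (x + a) / 2)) \<longlongrightarrow> 1) at_top"
    proof (rule filterlim_compose[OF tanh_real_at_top])
      have "filterlim (\<lambda>x. c / 2 * (a + x)) at_top at_top"
        using c by (intro filterlim_tendsto_pos_mult_at_top[OF tendsto_const]
            filterlim_tendsto_add_at_top[OF tendsto_const filterlim_ident]) simp
      then show "filterlim (\<lambda>x. c * (x + a) / 2) at_top at_top" by (simp add: add.commute)
    qed
    then have l1: "((\<lambda>x. ln (tanh (c * (x + a) / 2))) \<longlongrightarrow> ln 1) at_top"
      by (intro tendsto_ln) auto
    have l2: "((\<lambda>x. exp (- (c * x))) \<longlongrightarrow> 0) at_top" by (rule exp_minus_mult_tendsto_0[OF c])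
    show "(?G \<longlongrightarrow> 0) at_top"
      using tendsto_diff[OF tendsto_minus[OF l2] tendsto_mult[OF tendsto_const[of "sinh (c * a)"] l1]]
      by simp
  qed
  have "(\<integral>\<^sup>+x. ennreal (?g x) * indicator {0..} x \<partial>lborel) = ennreal (0 - ?G 0)"
    by (rule nn_integral_FTC_atLeast[OF _ g(2,1) G]) (use g_meas in simp_all)
  then show "(\<integral>\<^sup>+x. ennreal (?g x) * indicator {0..} x \<partial>lborel)
      = ennreal (1 + sinh (c * a) * ln (tanh (c * a / 2)))" by (simp add: add.commute)
  have "?G 0 \<le> ?G x" if "0 \<le> x" for x
    by (rule DERIV_nonneg_imp_nondecreasing[OF that]) (use g in blast)
  then have "?G 0 \<le> 0"
    by (intro tendsto_lowerbound[OF G]) (auto intro: eventually_at_top_linorderI[of 0])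
  then show "0 \<le> 1 + sinh (c * a) * ln (tanh (c * a / 2))" by simp
qed

lemma exp_tail_integral:
  fixes c X :: real
  assumes c: "0 < c" and X: "0 \<le> X"
  shows "(\<integral>\<^sup>+x. ennreal (c * exp (- (c * x)) * of_bool (X < x)) * indicator {0..} x \<partial>lborel) = ennreal (exp (- (c * X)))"
proof -
  have "(\<integral>\<^sup>+x. ennreal (c * exp (- (c * x)) * of_bool (X < x)) * indicator {0..} x \<partial>lborel)
      = (\<integral>\<^sup>+x. ennreal (c * exp (- (c * x))) * indicator {X..} x \<partial>lborel)"
  proof (rule nn_integral_cong_AE)
    show "AE x in lborel. ennreal (c * exp (- (c * x)) * of_bool (X < x)) * indicator {0..} x
        = ennreal (c * exp (- (c * x))) * indicator {X..} x"
      using AE_lborel_singleton[of X] by eventually_elim (use X in \<open>simp split: split_indicator\<close>)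
  qed
  also have "\<dots> = ennreal (0 - (- exp (- (c * X))))"
  proof (rule nn_integral_FTC_atLeast)
    show "((\<lambda>x. - exp (- (c * x))) has_real_derivative c * exp (- (c * x))) (at x)" for x
      by (auto intro!: derivative_eq_intros)
    have "((\<lambda>x. exp (- (c * x))) \<longlongrightarrow> 0) at_top" by (rule exp_minus_mult_tendsto_0[OF c])
    from tendsto_minus[OF this] show "((\<lambda>x. - exp (- (c * x))) \<longlongrightarrow> 0) at_top" by simp
  qed (use c in auto)
  finally show ?thesis by simp
qed

section \<open>The Laplace transform of the return time\<close>

context brownian_motion
begin

abbreviation W_path :: "'a \<Rightarrow> real \<Rightarrow> real" where
  "W_path \<omega> \<equiv> \<lambda>u. W u \<omega>"

lemma optional_sampling_const:
  assumes \<rho>: "stopping_time past \<rho>" "\<And>\<omega>. \<omega> \<in> space M \<Longrightarrow> 0 \<le> \<rho> \<omega> \<and> \<rho> \<omega> \<le> real N"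
  shows "(\<lambda>\<omega>. exp_mart \<theta> (\<rho> \<omega>) \<omega>) \<in> borel_measurable M"
    and "(\<integral>\<omega>. exp_mart \<theta> (\<rho> \<omega>) \<omega> \<partial>M) = 1"
proof -
  have "continuous_adapted (\<lambda>_ _. 1)" by (simp add: continuous_adapted_def)
  from optional_sampling[OF this _ stopping_time_const \<rho>(1), of 0 N \<theta>] \<rho>(2)
  show "(\<lambda>\<omega>. exp_mart \<theta> (\<rho> \<omega>) \<omega>) \<in> borel_measurable M" "(\<integral>\<omega>. exp_mart \<theta> (\<rho> \<omega>) \<omega> \<partial>M) = 1"
    by (simp_all add: prob_space)
qed

text \<open>Since \<open>W\<close> is \<open>- a\<close> or \<open>b\<close> on leaving the interval, the combination of the two martingales that
  vanishes at \<open>b\<close> isolates exits at \<open>- a\<close>. These are the paths that reach \<open>- a\<close> with a maximum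
  below \<open>b\<close>. Paths that never leave contribute nothing in the limit, as they are bounded while the
  discount tends to 0.\<close>

lemma exit_expectation:
  assumes c: "0 < c" and a: "0 < a" and b: "0 < b"
  shows "(\<integral>\<omega>. zero_discount (c\<^sup>2 / 2) (\<lambda>u. W u \<omega> + a) *
      of_bool (run_max (W_path \<omega>) (first_zero (\<lambda>u. W u \<omega> + a)) < b) \<partial>M)
    = sinh (c * b) / sinh (c * (b + a))"
proof -
  define Y where "Y u \<omega> = min (W u \<omega> + a) (b - W u \<omega>)" for u \<omega>
  define h where "h n \<omega> = first_hit (\<lambda>u. Y u \<omega>) (real n)" for n \<omega>
  define A where "A \<omega> = zero_discount (c\<^sup>2 / 2) (\<lambda>u. W u \<omega> + a) *
      of_bool (run_max (W_path \<omega>) (first_zero (\<lambda>u. W u \<omega> + a)) < b)" for \<omega>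
  \<comment> \<open>on exit the value is \<open>exp (- c\<^sup>2 / 2 * T)\<close> times \<open>2 * sinh (c * (b - W T))\<close>, which is 0 at \<open>W T = b\<close>\<close>
  define \<Delta> where "\<Delta> n \<omega> = exp (c * b) * exp_mart (- c) (h n \<omega>) \<omega>
      - exp (- (c * b)) * exp_mart c (h n \<omega>) \<omega>" for n \<omega>
  have ca: "continuous_adapted Y"
    using continuous_adaptedD[OF continuous_adapted_W]
    by (auto simp: continuous_adapted_def Y_def[abs_def] intro!: continuous_intros)
  note Yc = continuous_adaptedD(1)[OF ca]
  have Y0: "0 \<le> Y 0 \<omega>" for \<omega> using a b by (simp add: Y_def)
  have st: "stopping_time past (h n)" for n
    unfolding h_def[abs_def] by (rule stopping_time_first_hit[OF ca]) simp
  have h: "0 \<le> h n \<omega> \<and> h n \<omega> \<le> real n" for n \<omega>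
    unfolding h_def using first_hit_bounds[of "real n"] by auto
  note os = optional_sampling_const[OF st h]
  have bnd: "exp_mart \<theta> (h n \<omega>) \<omega> \<le> exp (c * (a + b))"
    if \<omega>: "\<omega> \<in> space M" and \<theta>: "\<theta> = c \<or> \<theta> = - c" for n \<omega> \<theta>
  proof -
    have "0 \<le> Y (h n \<omega>) \<omega>"
      unfolding h_def by (rule first_hit_nonneg[OF Yc[OF \<omega>] Y0]) simp
    then have "- a \<le> W (h n \<omega>) \<omega>" "W (h n \<omega>) \<omega> \<le> b" by (auto simp: Y_def)
    then have "\<bar>W (h n \<omega>) \<omega>\<bar> \<le> a + b" using a b by linarith
    then have "\<bar>\<theta> * W (h n \<omega>) \<omega>\<bar> \<le> c * (a + b)" using c \<theta> by (auto simp: abs_mult)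
    moreover have "0 \<le> \<theta>\<^sup>2 / 2 * h n \<omega>" using h[of n \<omega>] by simp
    ultimately show ?thesis by (simp add: exp_mart_def)
  qed
  have int: "integrable M (\<lambda>\<omega>. exp_mart \<theta> (h n \<omega>) \<omega>)" if "\<theta> = c \<or> \<theta> = - c" for n \<theta>
    by (rule integrable_const_bound[where B = "exp (c * (a + b))"]) (use bnd that os(1) in auto)
  have mean: "(\<integral>\<omega>. \<Delta> n \<omega> \<partial>M) = 2 * sinh (c * b)" for n
    unfolding \<Delta>_def using int[of c n] int[of "- c" n] os(2)[of _ n]
    by (simp add: sinh_def)
  have lim: "(\<lambda>n. \<Delta> n \<omega>) \<longlonglongrightarrow> 2 * sinh (c * (b + a)) * A \<omega>" if \<omega>: "\<omega> \<in> space M" for \<omega>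
  proof (cases "has_zero (\<lambda>u. Y u \<omega>)")
    case False
    note noz = no_zeroD[OF False]
    have "h n \<omega> = real n" for n unfolding h_def by (rule noz(2))
    then have \<Delta>eq: "\<Delta> n \<omega> = exp (c * b) * exp (- c * W (real n) \<omega> - c\<^sup>2 / 2 * real n)
        - exp (- (c * b)) * exp (c * W (real n) \<omega> - c\<^sup>2 / 2 * real n)" for n
      by (simp add: \<Delta>_def exp_mart_def)
    have W: "- a \<le> W (real n) \<omega>" "W (real n) \<omega> \<le> b" for n
      using noz(1)[of "real n"] by (auto simp: Y_def)
    have "(\<lambda>n. \<Delta> n \<omega>) \<longlonglongrightarrow> exp (c * b) * 0 - exp (- (c * b)) * 0"
      unfolding \<Delta>eq
    proof (intro tendsto_intros)
      show "(\<lambda>n. exp (- c * W (real n) \<omega> - c\<^sup>2 / 2 * real n)) \<longlonglongrightarrow> 0"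
      proof (rule exp_minus_time_tendsto_0)
        fix n
        have "c * (- W (real n) \<omega>) \<le> c * a"
          using W(1)[of n] c by (intro mult_left_mono) linarith+
        then show "- c * W (real n) \<omega> \<le> c * a" by simp
      qed (use c in simp)
      show "(\<lambda>n. exp (c * W (real n) \<omega> - c\<^sup>2 / 2 * real n)) \<longlonglongrightarrow> 0"
        by (rule exp_minus_time_tendsto_0[where K = "c * b"]) (use c W(2) in auto)
    qed
    moreover have "\<not> has_zero (\<lambda>u. W u \<omega> + a)"
      using noz(1) by (force simp: has_zero_def Y_def)
    ultimately show ?thesis by (simp add: A_def zero_discount_def)
  next
    case True
    define T where "T = first_zero (\<lambda>u. Y u \<omega>)"
    note z = has_zeroD[OF Yc[OF \<omega>] True, folded T_def]
    have YT: "Y T \<omega> = 0"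
      using z(2) first_zero_value[OF Yc[OF \<omega>] Y0 z(1,3)] by simp
    have "\<Delta> n \<omega> = exp (c * b) * exp_mart (- c) T \<omega> - exp (- (c * b)) * exp_mart c T \<omega>"
      if "nat \<lceil>T\<rceil> \<le> n" for n
    proof -
      have "T \<le> real n" using that by linarith
      then show ?thesis by (simp add: \<Delta>_def h_def z(4))
    qed
    then have lim1: "(\<lambda>n. \<Delta> n \<omega>) \<longlonglongrightarrow> exp (c * b) * exp_mart (- c) T \<omega> - exp (- (c * b)) * exp_mart c T \<omega>"
      by (intro tendsto_eventually eventually_sequentiallyI)
    have "exp (c * b) * exp_mart (- c) T \<omega> - exp (- (c * b)) * exp_mart c T \<omega> = 2 * sinh (c * (b + a)) * A \<omega>"
    proof (cases "W T \<omega> = - a")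
      case exit: True
      have pos: "0 < W v \<omega> + a" "W v \<omega> < b" if "0 \<le> v" "v < T" for v
        using z(3)[OF that] by (auto simp: Y_def)
      have H: "first_zero (\<lambda>u. W u \<omega> + a) = T"
        by (rule first_zero_eq) (use z(1) exit pos in auto)
      have "has_zero (\<lambda>u. W u \<omega> + a)" using z(1) exit by (auto simp: has_zero_def)
      moreover have "run_max (W_path \<omega>) T < b"
        unfolding run_max_less_iff[OF continuous_W[OF \<omega>] z(1)]
      proof (intro allI impI)
        fix s assume "0 \<le> s \<and> s \<le> T"
        then show "W s \<omega> < b" using pos[of s] exit a b by (cases "s = T") auto
      qed
      ultimately have "A \<omega> = exp (- (c\<^sup>2 / 2) * T)" by (simp add: A_def zero_discount_def H)
      then show ?thesis
        by (simp add: exp_mart_def exit sinh_def algebra_simps flip: exp_add)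
    next
      case False
      then have exit: "W T \<omega> = b" using YT by (auto simp: Y_def min_def split: if_splits)
      have "A \<omega> = 0"
      proof (cases "has_zero (\<lambda>u. W u \<omega> + a)")
        case hz: True
        define H where "H = first_zero (\<lambda>u. W u \<omega> + a)"
        note zH = has_zeroD[OF continuous_shift[OF continuous_W[OF \<omega>]] hz, folded H_def]
        have "T \<le> H"
        proof (rule ccontr)
          assume "\<not> T \<le> H"
          with z(3)[of H] zH(1,2) show False by (simp add: Y_def)
        qed
        with run_max_upper[OF continuous_W[OF \<omega>] z(1), of H] exit
        have "\<not> run_max (W_path \<omega>) H < b" by simp
        then show ?thesis by (simp add: A_def H_def)
      qed (simp add: A_def zero_discount_def)
      then show ?thesis
        by (simp add: exp_mart_def exit flip: exp_add)
    qed
    with lim1 show ?thesis by simp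
  qed
  have "(\<lambda>n. \<integral>\<omega>. \<Delta> n \<omega> \<partial>M) \<longlonglongrightarrow> (\<integral>\<omega>. 2 * sinh (c * (b + a)) * A \<omega> \<partial>M)"
  proof (rule integral_dominated_convergence
      [where w = "\<lambda>_. exp (c * b) * exp (c * (a + b)) + exp (- (c * b)) * exp (c * (a + b))"])
    have m: "\<Delta> n \<in> borel_measurable M" for n
      unfolding \<Delta>_def[abs_def] using os(1) by (intro borel_measurable_diff borel_measurable_times) auto
    then show "\<Delta> n \<in> borel_measurable M" for n .
    show "(\<lambda>\<omega>. 2 * sinh (c * (b + a)) * A \<omega>) \<in> borel_measurable M"
      by (rule borel_measurable_LIMSEQ_real[OF lim m])
    show "AE \<omega> in M. (\<lambda>n. \<Delta> n \<omega>) \<longlonglongrightarrow> 2 * sinh (c * (b + a)) * A \<omega>"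
      by (rule AE_I2) (rule lim)
    show "AE \<omega> in M. norm (\<Delta> n \<omega>)
        \<le> exp (c * b) * exp (c * (a + b)) + exp (- (c * b)) * exp (c * (a + b))" for n
    proof (rule AE_I2)
      fix \<omega> assume \<omega>: "\<omega> \<in> space M"
      have "norm (\<Delta> n \<omega>) \<le> exp (c * b) * exp_mart (- c) (h n \<omega>) \<omega> + exp (- (c * b)) * exp_mart c (h n \<omega>) \<omega>"
        unfolding \<Delta>_def by (rule order_trans[OF norm_triangle_ineq4]) simp
      also have "\<dots> \<le> exp (c * b) * exp (c * (a + b)) + exp (- (c * b)) * exp (c * (a + b))"
        using bnd[OF \<omega>] by (intro add_mono mult_left_mono) auto
      finally show "norm (\<Delta> n \<omega>) \<le> exp (c * b) * exp (c * (a + b)) + exp (- (c * b)) * exp (c * (a + b))" .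
    qed
  qed simp
  then have "2 * sinh (c * b) = (\<integral>\<omega>. 2 * sinh (c * (b + a)) * A \<omega> \<partial>M)"
    unfolding mean by (simp add: LIMSEQ_const_iff)
  moreover have "0 < sinh (c * (b + a))" using c a b by simp
  ultimately show ?thesis unfolding A_def[symmetric] by (simp add: field_simps)
qed

text \<open>Optional sampling between the descent to \<open>- a\<close> and the return, with the weight \<open>exp (- c * max W)\<close>
  taken at the descent. The weight cancels the martingale factor \<open>exp (c * W)\<close> at the return, where \<open>W\<close>
  has climbed back to that maximum, and bounds everything by 1 before.\<close>

lemma return_expectation:
  assumes c: "0 < c" and a: "0 < a"
  defines "D \<equiv> \<lambda>\<omega>. zero_discount (c\<^sup>2 / 2) (\<lambda>u. W u \<omega> + a)"
    and "X \<equiv> \<lambda>\<omega>. run_max (W_path \<omega>) (first_zero (\<lambda>u. W u \<omega> + a))"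
  shows "(\<lambda>\<omega>. zero_discount (c\<^sup>2 / 2) (return_gap a (W_path \<omega>))) \<in> borel_measurable M"
    and "D \<in> borel_measurable M" and "(\<lambda>\<omega>. D \<omega> * exp (- (c * X \<omega>))) \<in> borel_measurable M"
    and "(\<integral>\<omega>. zero_discount (c\<^sup>2 / 2) (return_gap a (W_path \<omega>)) \<partial>M)
       = exp (- (c * a)) * (\<integral>\<omega>. D \<omega> * exp (- (c * X \<omega>)) \<partial>M)"
proof -
  define z where "z t \<omega> = exp (- (c * run_max (W_path \<omega>) t))" for t \<omega>
  define \<tau> where "\<tau> n \<omega> = first_hit (\<lambda>u. W u \<omega> + a) (real n)" for n \<omega>
  define \<rho> where "\<rho> n \<omega> = first_hit (return_gap a (W_path \<omega>)) (real n)" for n \<omega>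
  define P where "P n \<omega> = z (\<tau> n \<omega>) \<omega> * exp_mart c (\<rho> n \<omega>) \<omega>" for n \<omega>
  define Q where "Q n \<omega> = z (\<tau> n \<omega>) \<omega> * exp_mart c (\<tau> n \<omega>) \<omega>" for n \<omega>
  have caS: "continuous_adapted (\<lambda>t \<omega>. run_max (W_path \<omega>) t)"
    by (rule continuous_adapted_run_max[OF continuous_adapted_W])
  have caz: "continuous_adapted z"
    using continuous_adaptedD[OF caS]
    by (auto simp: continuous_adapted_def z_def[abs_def] intro!: continuous_intros)
  have S0: "0 \<le> run_max (W_path \<omega>) t" if "\<omega> \<in> space M" "0 \<le> t" for \<omega> t
    using run_max_upper[OF continuous_W[OF that(1)], of 0 t] that by simp
  have z01: "0 \<le> z t \<omega> \<and> z t \<omega> \<le> 1" if "0 \<le> t" "\<omega> \<in> space M" for t \<omega>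
    using S0[OF that(2,1)] c by (simp add: z_def)
  have ca1: "continuous_adapted (\<lambda>u \<omega>. W u \<omega> + a)"
    using continuous_adaptedD[OF continuous_adapted_W]
    by (auto simp: continuous_adapted_def intro!: continuous_intros)
  have "continuous_adapted (\<lambda>u \<omega>. - W u \<omega>)"
    using continuous_adaptedD[OF continuous_adapted_W]
    by (auto simp: continuous_adapted_def intro!: continuous_intros)
  note caL = continuous_adapted_run_max[OF this]
  have ca2: "continuous_adapted (\<lambda>u \<omega>. return_gap a (W_path \<omega>) u)"
    using continuous_adaptedD[OF caS] continuous_adaptedD[OF caL] continuous_adaptedD[OF continuous_adapted_W]
    by (auto simp: continuous_adapted_def return_gap_def intro!: continuous_intros)
  have st\<tau>: "stopping_time past (\<tau> n)" and st\<rho>: "stopping_time past (\<rho> n)" for n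
    unfolding \<tau>_def[abs_def] \<rho>_def[abs_def]
    by (intro stopping_time_first_hit ca1 ca2; simp)+
  have ord: "0 \<le> \<tau> n \<omega> \<and> \<tau> n \<omega> \<le> \<rho> n \<omega> \<and> \<rho> n \<omega> \<le> real n" if "\<omega> \<in> space M" for n \<omega>
    unfolding \<tau>_def \<rho>_def using first_hit_bounds[of "real n"]
      first_hit_le_return[OF continuous_W[OF that], of "real n" a] by auto
  have PQ: "(\<integral>\<omega>. P n \<omega> \<partial>M) = (\<integral>\<omega>. Q n \<omega> \<partial>M)" and Pm: "P n \<in> borel_measurable M" for n
    unfolding P_def[abs_def] Q_def[abs_def]
    using optional_sampling[OF caz z01 st\<tau> st\<rho> ord, where \<theta> = c] by auto
  have Qm: "Q n \<in> borel_measurable M" for n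
    unfolding Q_def[abs_def]
    by (rule optional_sampling(1)[OF caz z01 st\<tau> st\<tau>, where N = n])
      (use ord[of _ n] in \<open>auto intro: order_trans\<close>)
  have Wle: "W (\<rho> n \<omega>) \<omega> \<le> run_max (W_path \<omega>) (\<tau> n \<omega>)"
    "W (\<tau> n \<omega>) \<omega> \<le> run_max (W_path \<omega>) (\<tau> n \<omega>)" if "\<omega> \<in> space M" for n \<omega>
    using value_at_return_le[OF continuous_W[OF that], of "real n" a]
      run_max_upper[OF continuous_W[OF that], of "\<tau> n \<omega>" "\<tau> n \<omega>"] ord[OF that, of n]
    by (auto simp: \<tau>_def \<rho>_def)
  have Peq: "P n \<omega> = exp (c * (W (\<rho> n \<omega>) \<omega> - run_max (W_path \<omega>) (\<tau> n \<omega>)) - c\<^sup>2 / 2 * \<rho> n \<omega>)"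
    and Qeq: "Q n \<omega> = exp (c * (W (\<tau> n \<omega>) \<omega> - run_max (W_path \<omega>) (\<tau> n \<omega>)) - c\<^sup>2 / 2 * \<tau> n \<omega>)" for n \<omega>
    by (simp_all add: P_def Q_def z_def exp_mart_def algebra_simps flip: exp_add)
  have Pb: "norm (P n \<omega>) \<le> 1" and Qb: "norm (Q n \<omega>) \<le> 1" if "\<omega> \<in> space M" for n \<omega>
  proof -
    have "c * (W (\<rho> n \<omega>) \<omega> - run_max (W_path \<omega>) (\<tau> n \<omega>)) \<le> 0"
      "c * (W (\<tau> n \<omega>) \<omega> - run_max (W_path \<omega>) (\<tau> n \<omega>)) \<le> 0"
      "0 \<le> c\<^sup>2 / 2 * \<rho> n \<omega>" "0 \<le> c\<^sup>2 / 2 * \<tau> n \<omega>"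
      using Wle[OF that, of n] ord[OF that, of n] c by (auto intro: mult_nonneg_nonpos)
    then show "norm (P n \<omega>) \<le> 1" "norm (Q n \<omega>) \<le> 1" by (simp_all add: Peq Qeq)
  qed
  have limP: "(\<lambda>n. P n \<omega>) \<longlonglongrightarrow> zero_discount (c\<^sup>2 / 2) (return_gap a (W_path \<omega>))"
    if \<omega>: "\<omega> \<in> space M" for \<omega>
  proof (cases "has_zero (return_gap a (W_path \<omega>))")
    case False
    have \<rho>n: "\<rho> n \<omega> = real n" for n unfolding \<rho>_def by (rule no_zeroD(2)[OF False])
    have "(\<lambda>n. P n \<omega>) \<longlonglongrightarrow> 0"
      unfolding Peq \<rho>n
    proof (rule exp_minus_time_tendsto_0[where K = 0])
      show "c * (W (real n) \<omega> - run_max (W_path \<omega>) (\<tau> n \<omega>)) \<le> 0" for n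
        using Wle(1)[OF \<omega>, of n] c unfolding \<rho>n by (auto intro: mult_nonneg_nonpos)
    qed (use c in simp)
    then show ?thesis using False by (simp add: zero_discount_def)
  next
    case True
    define T where "T = first_zero (return_gap a (W_path \<omega>))"
    note gc = continuous_on_return_gap[OF continuous_W[OF \<omega>], of a]
    note z = has_zeroD[OF gc True, folded T_def]
    have "P n \<omega> = exp (- (c\<^sup>2 / 2) * T)" if "nat \<lceil>T\<rceil> \<le> n" for n
    proof -
      have "T \<le> real n" using that by linarith
      then have \<rho>T: "\<rho> n \<omega> = T" by (simp add: \<rho>_def z(4))
      have "run_max (W_path \<omega>) T \<le> W T \<omega>"
        using z(2) return_gap_nonpos_iff[OF continuous_W[OF \<omega>] z(1)] by simp
      moreover have "run_max (W_path \<omega>) (\<tau> n \<omega>) \<le> run_max (W_path \<omega>) T"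
        using ord[OF \<omega>, of n] \<rho>T by (intro run_max_mono[OF continuous_W[OF \<omega>]]) auto
      ultimately have "W T \<omega> = run_max (W_path \<omega>) (\<tau> n \<omega>)" using Wle(1)[OF \<omega>, of n] \<rho>T by simp
      then show ?thesis by (simp add: Peq \<rho>T)
    qed
    then have "(\<lambda>n. P n \<omega>) \<longlonglongrightarrow> exp (- (c\<^sup>2 / 2) * T)"
      by (intro tendsto_eventually eventually_sequentiallyI)
    then show ?thesis using True by (simp add: zero_discount_def T_def)
  qed
  have limQ: "(\<lambda>n. Q n \<omega>) \<longlonglongrightarrow> exp (- (c * a)) * (D \<omega> * exp (- (c * X \<omega>)))"
    if \<omega>: "\<omega> \<in> space M" for \<omega>
  proof -
    note sc = continuous_shift[OF continuous_W[OF \<omega>], of a]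
    show ?thesis
    proof (cases "has_zero (\<lambda>u. W u \<omega> + a)")
      case False
      have \<tau>n: "\<tau> n \<omega> = real n" for n unfolding \<tau>_def by (rule no_zeroD(2)[OF False])
      have "(\<lambda>n. Q n \<omega>) \<longlonglongrightarrow> 0"
        unfolding Qeq \<tau>n
      proof (rule exp_minus_time_tendsto_0[where K = 0])
        show "c * (W (real n) \<omega> - run_max (W_path \<omega>) (real n)) \<le> 0" for n
          using Wle(2)[OF \<omega>, of n] c unfolding \<tau>n by (auto intro: mult_nonneg_nonpos)
      qed (use c in simp)
      then show ?thesis using False by (simp add: D_def zero_discount_def)
    next
      case True
      define H where "H = first_zero (\<lambda>u. W u \<omega> + a)"
      note z = has_zeroD[OF sc True, folded H_def]
      have "0 \<le> W H \<omega> + a" by (rule first_zero_value[OF sc _ z(1,3)]) (use a in auto)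
      with z(2) have WH: "W H \<omega> = - a" by simp
      have \<tau>H: "\<tau> n \<omega> = H" if "nat \<lceil>H\<rceil> \<le> n" for n
      proof -
        have "H \<le> real n" using that by linarith
        then show ?thesis by (simp add: \<tau>_def z(4))
      qed
      have DX: "D \<omega> = exp (- (c\<^sup>2 / 2) * H)" "X \<omega> = run_max (W_path \<omega>) H"
        using True by (simp_all add: D_def X_def zero_discount_def H_def)
      have "Q n \<omega> = exp (- (c * a)) * (D \<omega> * exp (- (c * X \<omega>)))" if "nat \<lceil>H\<rceil> \<le> n" for n
        unfolding Qeq \<tau>H[OF that] WH DX by (simp add: algebra_simps flip: exp_add)
      then show ?thesis
        by (intro tendsto_eventually eventually_sequentiallyI)
    qed
  qed
  show "(\<lambda>\<omega>. zero_discount (c\<^sup>2 / 2) (return_gap a (W_path \<omega>))) \<in> borel_measurable M"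
    by (rule borel_measurable_LIMSEQ_real[OF limP Pm])
  show "D \<in> borel_measurable M"
    unfolding D_def
    by (rule measurable_zero_discount)
      (use c measurable_W in \<open>auto intro!: continuous_shift continuous_W\<close>)
  have Em: "(\<lambda>\<omega>. exp (- (c * a)) * (D \<omega> * exp (- (c * X \<omega>)))) \<in> borel_measurable M"
    by (rule borel_measurable_LIMSEQ_real[OF limQ Qm])
  from borel_measurable_times[OF borel_measurable_const[of "exp (c * a)"] Em]
  show "(\<lambda>\<omega>. D \<omega> * exp (- (c * X \<omega>))) \<in> borel_measurable M"
    by (simp add: mult.assoc[symmetric] flip: exp_add)
  have "(\<lambda>n. \<integral>\<omega>. P n \<omega> \<partial>M) \<longlonglongrightarrow> (\<integral>\<omega>. zero_discount (c\<^sup>2 / 2) (return_gap a (W_path \<omega>)) \<partial>M)"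
    by (rule integral_dominated_convergence[where w = "\<lambda>_. 1"])
      (auto intro!: AE_I2 limP Pm borel_measurable_LIMSEQ_real[OF limP Pm] Pb[unfolded real_norm_def])
  moreover have "(\<lambda>n. \<integral>\<omega>. Q n \<omega> \<partial>M)
      \<longlonglongrightarrow> (\<integral>\<omega>. exp (- (c * a)) * (D \<omega> * exp (- (c * X \<omega>))) \<partial>M)"
    by (rule integral_dominated_convergence[where w = "\<lambda>_. 1"])
      (auto intro!: AE_I2 limQ Qm Em Qb[unfolded real_norm_def])
  ultimately have "(\<integral>\<omega>. zero_discount (c\<^sup>2 / 2) (return_gap a (W_path \<omega>)) \<partial>M)
      = (\<integral>\<omega>. exp (- (c * a)) * (D \<omega> * exp (- (c * X \<omega>))) \<partial>M)"
    unfolding PQ by (rule LIMSEQ_unique)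
  then show "(\<integral>\<omega>. zero_discount (c\<^sup>2 / 2) (return_gap a (W_path \<omega>)) \<partial>M)
      = exp (- (c * a)) * (\<integral>\<omega>. D \<omega> * exp (- (c * X \<omega>)) \<partial>M)" by simp
qed

text \<open>Conditioning on the maximum is avoided: \<open>exp (- c X)\<close> is the integral of \<open>c * exp (- c x)\<close> over
  \<open>x > X\<close>, so that by the theorem of Tonelli only the discounted expectations from the exit problem enter.\<close>

lemma return_laplace:
  assumes c: "0 < c" and a: "0 < a"
  shows "(\<integral>\<omega>. zero_discount (c\<^sup>2 / 2) (return_gap a (W_path \<omega>)) \<partial>M)
    = 1 + sinh (c * a) * ln (tanh (c * a / 2))"
proof -
  define D where "D \<omega> = zero_discount (c\<^sup>2 / 2) (\<lambda>u. W u \<omega> + a)" for \<omega>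
  define X where "X \<omega> = run_max (W_path \<omega>) (first_zero (\<lambda>u. W u \<omega> + a))" for \<omega>
  note re = return_expectation[OF c a, folded D_def X_def]
  define E where "E \<omega> = D \<omega> * exp (- (c * X \<omega>))" for \<omega>
  have [measurable]: "D \<in> borel_measurable M" "E \<in> borel_measurable M"
    using re(2,3) by (simp_all add: E_def[abs_def])
  have D0: "0 \<le> D \<omega>" for \<omega> by (simp add: D_def zero_discount_def)
  have D1: "D \<omega> \<le> 1" and X0: "D \<omega> \<noteq> 0 \<Longrightarrow> 0 \<le> X \<omega>" if \<omega>: "\<omega> \<in> space M" for \<omega>
  proof -
    note sc = continuous_shift[OF continuous_W[OF \<omega>], of a]
    have "has_zero (\<lambda>u. W u \<omega> + a) \<Longrightarrow> 0 \<le> first_zero (\<lambda>u. W u \<omega> + a)"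
      by (rule has_zeroD(1)[OF sc])
    then show "D \<omega> \<le> 1" "D \<omega> \<noteq> 0 \<Longrightarrow> 0 \<le> X \<omega>"
      using run_max_upper[OF continuous_W[OF \<omega>], of 0 "first_zero (\<lambda>u. W u \<omega> + a)"] c
      by (auto simp: D_def X_def zero_discount_def split: if_splits)
  qed
  \<comment> \<open>a measurable version of \<open>X\<close>, the two agree wherever the weight \<open>D\<close> does not vanish\<close>
  define X' where "X' \<omega> = ln (D \<omega> / E \<omega>) / c" for \<omega>
  have [measurable]: "X' \<in> borel_measurable M" unfolding X'_def[abs_def] by measurable
  have X': "X' \<omega> = X \<omega>" if "D \<omega> \<noteq> 0" for \<omega>
  proof -
    have "D \<omega> / E \<omega> = exp (c * X \<omega>)" using that by (simp add: E_def exp_minus field_simps)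
    then show ?thesis using c by (simp add: X'_def)
  qed
  define k where "k x \<omega> = c * exp (- (c * x)) * (D \<omega> * of_bool (X' \<omega> < x))" for x \<omega>
  have k: "(\<integral>\<^sup>+\<omega>. ennreal (k x \<omega>) \<partial>M)
      = ennreal (c * exp (- (c * x)) * (sinh (c * x) / sinh (c * (x + a))))" if x: "0 \<le> x" for x
  proof -
    have DX: "D \<omega> * of_bool (X' \<omega> < x) = D \<omega> * of_bool (X \<omega> < x)" for \<omega>
      using X'[of \<omega>] by (cases "D \<omega> = 0") auto
    have "(\<integral>\<omega>. D \<omega> * of_bool (X' \<omega> < x) \<partial>M) = sinh (c * x) / sinh (c * (x + a))"
    proof (cases "x = 0")
      case True
      have "(\<integral>\<omega>. D \<omega> * of_bool (X \<omega> < x) \<partial>M) = (\<integral>\<omega>. 0 \<partial>M)"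
        by (rule Bochner_Integration.integral_cong) (use X0 True in force)+
      then show ?thesis unfolding DX using True by simp
    next
      case False
      with x have "0 < x" by simp
      from exit_expectation[OF c a this] show ?thesis unfolding DX by (simp add: D_def X_def)
    qed
    moreover have "integrable M (\<lambda>\<omega>. D \<omega> * of_bool (X' \<omega> < x))"
      by (rule integrable_const_bound[where B = 1]) (use D0 D1 in \<open>auto intro!: AE_I2\<close>)
    ultimately show ?thesis
      using c D0 unfolding k_def by (subst nn_integral_eq_integral) auto
  qed
  have inner: "(\<integral>\<^sup>+x. ennreal (k x \<omega>) * indicator {0..} x \<partial>lborel) = ennreal (E \<omega>)"
    if \<omega>: "\<omega> \<in> space M" for \<omega>
  proof (cases "D \<omega> = 0")
    case False
    have "(\<integral>\<^sup>+x. ennreal (k x \<omega>) * indicator {0..} x \<partial>lborel)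
        = (\<integral>\<^sup>+x. ennreal (D \<omega>) * (ennreal (c * exp (- (c * x)) * of_bool (X \<omega> < x)) * indicator {0..} x) \<partial>lborel)"
      using c D0[of \<omega>] by (intro nn_integral_cong)
        (simp add: k_def X'[OF False] ennreal_mult[symmetric] mult_ac split: split_indicator)
    also have "\<dots> = ennreal (D \<omega>) * ennreal (exp (- (c * X \<omega>)))"
      by (subst nn_integral_cmult) (simp_all add: exp_tail_integral[OF c X0[OF \<omega> False]])
    finally show ?thesis using D0 by (simp add: E_def ennreal_mult)
  qed (simp add: k_def E_def)
  interpret pair_sigma_finite M lborel ..
  have km [measurable]: "(\<lambda>(\<omega>, x). ennreal (k x \<omega>) * indicator {0..} x) \<in> borel_measurable (M \<Otimes>\<^sub>M lborel)"
    unfolding k_def by measurable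
  have "(\<integral>\<^sup>+\<omega>. ennreal (E \<omega>) \<partial>M) = (\<integral>\<^sup>+\<omega>. (\<integral>\<^sup>+x. ennreal (k x \<omega>) * indicator {0..} x \<partial>lborel) \<partial>M)"
    by (rule nn_integral_cong) (simp add: inner)
  also have "\<dots> = (\<integral>\<^sup>+x. (\<integral>\<^sup>+\<omega>. ennreal (k x \<omega>) * indicator {0..} x \<partial>M) \<partial>lborel)"
    using Fubini'[OF km] by simp
  also have "\<dots> = (\<integral>\<^sup>+x. ennreal (c * exp (- (c * x)) * (sinh (c * x) / sinh (c * (x + a)))) * indicator {0..} x \<partial>lborel)"
  proof (rule nn_integral_cong)
    fix x :: real
    show "(\<integral>\<^sup>+\<omega>. ennreal (k x \<omega>) * indicator {0..} x \<partial>M)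
        = ennreal (c * exp (- (c * x)) * (sinh (c * x) / sinh (c * (x + a)))) * indicator {0..} x"
      using k[of x] by (cases "0 \<le> x") simp_all
  qed
  finally have E_nn: "(\<integral>\<^sup>+\<omega>. ennreal (E \<omega>) \<partial>M) = \<dots>" .
  have "(\<integral>\<^sup>+\<omega>. ennreal (exp (- (c * a)) * E \<omega>) \<partial>M) = ennreal (exp (- (c * a))) * (\<integral>\<^sup>+\<omega>. ennreal (E \<omega>) \<partial>M)"
    by (simp add: ennreal_mult' nn_integral_cmult)
  also have "\<dots> = (\<integral>\<^sup>+x. ennreal (c * exp (- (c * (x + a))) * (sinh (c * x) / sinh (c * (x + a)))) * indicator {0..} x \<partial>lborel)"
    unfolding E_nn
  proof (subst nn_integral_cmult[symmetric])
    show "(\<lambda>x. ennreal (c * exp (- (c * x)) * (sinh (c * x) / sinh (c * (x + a)))) * indicator {0..} x)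
        \<in> borel_measurable lborel" unfolding sinh_def by measurable
    have e: "exp (- (c * (x + a))) = exp (- (c * a)) * exp (- (c * x))" for x
      by (simp add: algebra_simps flip: exp_add)
    show "(\<integral>\<^sup>+x. ennreal (exp (- (c * a))) *
          (ennreal (c * exp (- (c * x)) * (sinh (c * x) / sinh (c * (x + a)))) * indicator {0..} x) \<partial>lborel)
        = (\<integral>\<^sup>+x. ennreal (c * exp (- (c * (x + a))) * (sinh (c * x) / sinh (c * (x + a)))) * indicator {0..} x \<partial>lborel)"
      unfolding e by (intro nn_integral_cong) (simp add: ennreal_mult'[symmetric] mult_ac split: split_indicator)
  qed
  also have "\<dots> = ennreal (1 + sinh (c * a) * ln (tanh (c * a / 2)))"
    by (rule exit_integral(1)[OF c a])
  finally have nn: "(\<integral>\<^sup>+\<omega>. ennreal (exp (- (c * a)) * E \<omega>) \<partial>M) = ennreal (1 + sinh (c * a) * ln (tanh (c * a / 2)))" .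
  have "(\<integral>\<omega>. exp (- (c * a)) * E \<omega> \<partial>M) = enn2real (\<integral>\<^sup>+\<omega>. ennreal (exp (- (c * a)) * E \<omega>) \<partial>M)"
    by (rule integral_eq_nn_integral) (measurable, use D0 in \<open>auto simp: E_def\<close>)
  then show ?thesis
    unfolding re(4) E_def[symmetric] using nn exit_integral(2)[OF c a] by simp
qed

end

section \<open>The coupling\<close>

text \<open>Before meeting, \<open>B\<close> and \<open>B'\<close> are mirror images, so they meet when \<open>B\<close> has dropped by \<open>a\<close>. From then
  on they coincide at least until \<open>B\<close> is back at its maximum \<open>l\<close>: before that time \<open>B\<close> stays below
  \<open>l\<close>, so synchronization has not ended, and \<open>B'\<close> has not reached \<open>l\<close> either, so that the maxima
  still differ.\<close>

lemma coupling_time_eq_return: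
  fixes B B' :: "real \<Rightarrow> 'a \<Rightarrow> real"
  assumes contB: "continuous_on {0..} (\<lambda>t. B t \<omega>)" and contB': "continuous_on {0..} (\<lambda>t. B' t \<omega>)"
    and start: "B 0 \<omega> = b0" "B' 0 \<omega> = b0'" and less: "b0' < b0"
    and reflection: "\<And>s t. 0 \<le> s \<Longrightarrow> s \<le> t \<Longrightarrow> ereal t \<le> meeting_time B B' \<omega> \<Longrightarrow>
      B' t \<omega> - B' s \<omega> = - (B t \<omega> - B s \<omega>)"
    and synchronization: "\<And>T1 s t. meeting_time B B' \<omega> = ereal T1 \<Longrightarrow>
      (B T1 \<omega>, running_max b0 B T1 \<omega>) \<noteq> (B' T1 \<omega>, running_max b0' B' T1 \<omega>) \<Longrightarrow>
      T1 \<le> s \<Longrightarrow> s \<le> t \<Longrightarrow> ereal t \<le> synchronization_time b0 b0' B B' \<omega> \<Longrightarrow>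
      B' t \<omega> - B' s \<omega> = B t \<omega> - B s \<omega>"
  shows "exp_discount \<alpha> (coupling_time b0 b0' B B' \<omega>)
    = zero_discount \<alpha> (return_gap ((b0 - b0') / 2) (\<lambda>u. B u \<omega> - B 0 \<omega>))"
proof -
  define a where "a = (b0 - b0') / 2"
  define f where "f u = B u \<omega> - B 0 \<omega>" for u
  have a: "0 < a" using less by (simp add: a_def)
  have f: "continuous_on {0..} f" unfolding f_def by (intro continuous_intros contB)
  have f0: "f 0 = 0" by (simp add: f_def)
  have Bf: "B t \<omega> = b0 + f t" for t by (simp add: f_def start)
  have reflected: "B' t \<omega> = b0' - f t" if "0 \<le> t" "ereal t \<le> meeting_time B B' \<omega>" for t
    using reflection[OF order_refl that] by (simp add: f_def start)
  have meet_iff: "b0 + y = b0' - y \<longleftrightarrow> y = - a" for y by (auto simp: a_def field_simps)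
  note gap = return_gap_nonpos_iff[OF f, of _ a]
  show ?thesis
  proof (cases "has_zero (\<lambda>u. f u + a)")
    case False
    note noz = no_zeroD(1)[OF False]
    have never: "B t \<omega> \<noteq> B' t \<omega>" if t: "0 \<le> t" for t
    proof
      assume "B t \<omega> = B' t \<omega>"
      with t have "has_zero (\<lambda>u. B u \<omega> - B' u \<omega>)" by (auto simp: has_zero_def)
      note z = has_zeroD[OF _ this]
      have cd: "continuous_on {0..} (\<lambda>u. B u \<omega> - B' u \<omega>)" by (intro continuous_intros contB contB')
      let ?T = "first_zero (\<lambda>u. B u \<omega> - B' u \<omega>)"
      have "0 \<le> B ?T \<omega> - B' ?T \<omega>"
        by (rule first_zero_value[OF cd _ z(1)[OF cd] z(3)[OF cd]]) (use start less in auto)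
      with z(2)[OF cd] have eq: "B ?T \<omega> = B' ?T \<omega>" by simp
      have "ereal ?T \<le> meeting_time B B' \<omega>"
        unfolding meeting_time_def
      proof (rule Inf_greatest)
        fix x assume "x \<in> {ereal t |t. 0 \<le> t \<and> B t \<omega> = B' t \<omega>}"
        then obtain u where u: "x = ereal u" "0 \<le> u" "B u \<omega> = B' u \<omega>" by blast
        with z(3)[OF cd u(2)] show "ereal ?T \<le> x" by (cases "u < ?T") auto
      qed
      from reflected[OF z(1)[OF cd] this] eq have "f ?T = - a" using meet_iff by (simp add: Bf)
      with noz[OF z(1)[OF cd]] show False by simp
    qed
    then have "{ereal t |t. 0 \<le> t \<and> (B t \<omega>, running_max b0 B t \<omega>) = (B' t \<omega>, running_max b0' B' t \<omega>)} = {}"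
      by blast
    then have "coupling_time b0 b0' B B' \<omega> = Inf {}" unfolding coupling_time_def by presburger
    then have "coupling_time b0 b0' B B' \<omega> = \<infinity>" by (simp add: top_ereal_def)
    moreover have "\<not> has_zero (return_gap a f)"
    proof
      assume "has_zero (return_gap a f)"
      then obtain u v where "0 \<le> v" "f v + a \<le> 0" unfolding has_zero_def using gap by blast
      with noz[of v] show False by simp
    qed
    ultimately show ?thesis
      by (simp add: exp_discount_def zero_discount_def a_def[symmetric] f_def[abs_def, symmetric])
  next
    case True
    define H where "H = first_zero (\<lambda>u. f u + a)"
    note z = has_zeroD[OF continuous_shift[OF f] True, folded H_def]
    have "0 \<le> f H + a" by (rule first_zero_value[OF continuous_shift[OF f] _ z(1,3)]) (use a f0 in auto)
    with z(2) have fH: "f H = - a" by simp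
    have H_pos: "0 < H" using z(1) fH f0 a by (cases "H = 0") auto
    have meeting: "meeting_time B B' \<omega> = ereal H"
    proof (rule antisym)
      show "ereal H \<le> meeting_time B B' \<omega>"
      proof (rule ccontr)
        assume "\<not> ereal H \<le> meeting_time B B' \<omega>"
        then obtain u where u: "0 \<le> u" "B u \<omega> = B' u \<omega>" "u < H"
          unfolding meeting_time_def not_le Inf_less_iff by auto
        have cd: "continuous_on {0..} (\<lambda>u. B u \<omega> - B' u \<omega>)" by (intro continuous_intros contB contB')
        have hz: "has_zero (\<lambda>u. B u \<omega> - B' u \<omega>)" using u by (auto simp: has_zero_def)
        note m = has_zeroD[OF cd hz]
        let ?T = "first_zero (\<lambda>u. B u \<omega> - B' u \<omega>)"
        have "0 \<le> B ?T \<omega> - B' ?T \<omega>"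
          by (rule first_zero_value[OF cd _ m(1,3)]) (use start less in auto)
        with m(2) have eq: "B ?T \<omega> = B' ?T \<omega>" by simp
        have TH: "?T < H" using m(3)[of u] u by (cases "u < ?T") auto
        have "ereal ?T \<le> meeting_time B B' \<omega>"
          unfolding meeting_time_def
        proof (rule Inf_greatest)
          fix x assume "x \<in> {ereal t |t. 0 \<le> t \<and> B t \<omega> = B' t \<omega>}"
          then obtain v where v: "x = ereal v" "0 \<le> v" "B v \<omega> = B' v \<omega>" by blast
          with m(3)[OF v(2)] show "ereal ?T \<le> x" by (cases "v < ?T") auto
        qed
        from reflected[OF m(1) this] eq have "f ?T = - a" using meet_iff by (simp add: Bf)
        with z(3)[OF m(1) TH] show False by simp
      qed
      with reflected[OF z(1)] have "B' H \<omega> = b0' + a" by (simp add: fH)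
      then have "B H \<omega> = B' H \<omega>" by (simp add: Bf fH a_def field_simps)
      then show "meeting_time B B' \<omega> \<le> ereal H"
        unfolding meeting_time_def using z(1) by (intro Inf_lower) auto
    qed
    have B'_before: "B' t \<omega> = b0' - f t" "B' t \<omega> \<le> b0' + a" if "0 \<le> t" "t \<le> H" for t
    proof -
      show "B' t \<omega> = b0' - f t" using reflected[of t] that meeting by simp
      then show "B' t \<omega> \<le> b0' + a" using z(3)[of t] that fH by (cases "t = H") auto
    qed
    have apart: "B t \<omega> \<noteq> B' t \<omega>" if "0 \<le> t" "t < H" for t
      using B'_before(1)[of t] z(3)[OF that] that meet_iff[of "f t"] by (auto simp: Bf)
    define l where "l = b0 + run_max f H"
    have l0: "b0 \<le> l" using run_max_upper[OF f, of 0 H] z(1) f0 by (simp add: l_def)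
    have mid: "b0' + a < b0" "b0' < b0" using less by (simp_all add: a_def field_simps)
    have SUP_B: "(SUP s\<in>{0..t}. B s \<omega>) = b0 + run_max f t" if "0 \<le> t" for t
    proof -
      have "run_max (\<lambda>s. B s \<omega>) t = b0 + run_max f t"
      proof (rule antisym)
        show "run_max (\<lambda>s. B s \<omega>) t \<le> b0 + run_max f t"
          by (rule run_max_attained[OF contB that]) (use run_max_upper[OF f] Bf in auto)
        show "b0 + run_max f t \<le> run_max (\<lambda>s. B s \<omega>) t"
          by (rule run_max_attained[OF f that]) (use run_max_upper[OF contB] Bf in metis)
      qed
      then show ?thesis by (simp add: run_max_def)
    qed
    have S: "running_max b0 B t \<omega> = b0 + run_max f t" if "0 \<le> t" for t
      using run_max_upper[OF f, of 0 t] that f0 by (simp add: running_max_def SUP_B)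
    have S': "running_max b0' B' t \<omega> = run_max (\<lambda>s. B' s \<omega>) t" if "0 \<le> t" for t
      using run_max_upper[OF contB', of 0 t] that start by (simp add: running_max_def run_max_def[symmetric])
    have "running_max b0' B' H \<omega> < b0"
      unfolding S'[OF z(1)] run_max_less_iff[OF contB' z(1)] using B'_before(2) mid by force
    then have not_coupled: "(B H \<omega>, running_max b0 B H \<omega>) \<noteq> (B' H \<omega>, running_max b0' B' H \<omega>)"
      using l0 by (simp add: S[OF z(1)] l_def)
    have sync_eq: "synchronization_time b0 b0' B B' \<omega> =
        Inf {ereal t |t. H < t \<and> B t \<omega> = B' t \<omega> \<and> B' t \<omega> = l}"
      unfolding synchronization_time_def meeting
      using l0 mid by (simp add: S[OF z(1)] l_def[symmetric] max_def)
    have below: "f u < run_max f H" if u: "H \<le> u" and no: "\<And>v. 0 \<le> v \<Longrightarrow> v \<le> u \<Longrightarrow> 0 < return_gap a f v" for u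
    proof -
      have u0: "0 \<le> u" using u z(1) by simp
      have "run_max f u = run_max f H"
        by (rule run_max_before_return[OF f z(1,2) u]) (use no in auto)
      moreover have "f u < run_max f u"
        using no[OF u0 order_refl] gap[OF u0] z(1,2) u by (auto simp: not_le[symmetric])
      ultimately show ?thesis by simp
    qed
    have in_sync: "B' t \<omega> = B t \<omega>"
      if t: "H \<le> t" and no: "\<And>v. 0 \<le> v \<Longrightarrow> v < t \<Longrightarrow> 0 < return_gap a f v" for t
    proof -
      have "ereal t \<le> synchronization_time b0 b0' B B' \<omega>"
        unfolding sync_eq
      proof (rule Inf_greatest)
        fix x assume "x \<in> {ereal t |t. H < t \<and> B t \<omega> = B' t \<omega> \<and> B' t \<omega> = l}"
        then obtain u where u: "x = ereal u" "H < u" "B u \<omega> = l" by auto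
        then have "f u = run_max f H" by (simp add: Bf l_def)
        with below[of u] u(2) no have "\<not> u < t" by force
        with u show "ereal t \<le> x" by simp
      qed
      from synchronization[OF meeting not_coupled order_refl t this] B'_before(1)[of H] z(1)
      show ?thesis by (simp add: Bf fH a_def field_simps)
    qed
    have uncoupled: "(B t \<omega>, running_max b0 B t \<omega>) \<noteq> (B' t \<omega>, running_max b0' B' t \<omega>)"
      if t: "0 \<le> t" and no: "\<And>v. 0 \<le> v \<Longrightarrow> v \<le> t \<Longrightarrow> 0 < return_gap a f v" for t
    proof (cases "t < H")
      case True
      then show ?thesis using apart[OF t] by simp
    next
      case False
      have "running_max b0' B' t \<omega> < l"
        unfolding S'[OF t] run_max_less_iff[OF contB' t]
      proof (intro allI impI)
        fix s assume s: "0 \<le> s \<and> s \<le> t"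
        show "B' s \<omega> < l"
        proof (cases "s \<le> H")
          case True
          then show ?thesis using B'_before(2)[of s] s l0 mid by simp
        next
          case False
          then have "B' s \<omega> = B s \<omega>" by (intro in_sync) (use no s in auto)
          moreover have "f s < run_max f H" by (rule below) (use no s False in auto)
          ultimately show ?thesis by (simp add: Bf l_def)
        qed
      qed
      moreover have "l \<le> running_max b0 B t \<omega>"
        using run_max_mono[OF f z(1), of t] False by (simp add: S[OF t] l_def)
      ultimately show ?thesis by simp
    qed
    show ?thesis
    proof (cases "has_zero (return_gap a f)")
      case no_return: False
      have "{ereal t |t. 0 \<le> t \<and> (B t \<omega>, running_max b0 B t \<omega>) = (B' t \<omega>, running_max b0' B' t \<omega>)} = {}"
        using uncoupled no_zeroD(1)[OF no_return] by blast
      then have "coupling_time b0 b0' B B' \<omega> = Inf {}" unfolding coupling_time_def by presburger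
      then have "coupling_time b0 b0' B B' \<omega> = \<infinity>" by (simp add: top_ereal_def)
      with no_return show ?thesis
        by (simp add: exp_discount_def zero_discount_def a_def[symmetric] f_def[abs_def, symmetric])
    next
      case hz: True
      define T where "T = first_zero (return_gap a f)"
      note r = has_zeroD[OF continuous_on_return_gap[OF f] hz, folded T_def]
      from r(2) gap[OF r(1)] obtain v where v: "0 \<le> v" "v \<le> T" "f v + a \<le> 0" and top: "run_max f T \<le> f T"
        by blast
      have HT: "H \<le> T" using z(3)[OF v(1)] v by (cases "v < H") auto
      have ST: "run_max f T = run_max f H" by (rule run_max_before_return[OF f z(1,2) HT r(3)])
      have fT: "f T = run_max f H" using top ST run_max_upper[OF f r(1), of T] by simp
      have B'T: "B' T \<omega> = B T \<omega>" by (rule in_sync[OF HT r(3)])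
      have "running_max b0' B' T \<omega> = l"
      proof (rule antisym)
        show "running_max b0' B' T \<omega> \<le> l"
          unfolding S'[OF r(1)]
        proof (rule run_max_attained[OF contB' r(1)])
          fix s assume s: "0 \<le> s" "s \<le> T" "run_max (\<lambda>s. B' s \<omega>) T = B' s \<omega>"
          have "B' s \<omega> \<le> l"
          proof (cases "s \<le> H")
            case True
            then show ?thesis using B'_before(2)[of s] s l0 mid by simp
          next
            case False
            then have "B' s \<omega> = B s \<omega>" by (intro in_sync) (use r(3) s in auto)
            then show ?thesis using run_max_upper[OF f s(1,2)] ST by (simp add: Bf l_def)
          qed
          with s show "run_max (\<lambda>s. B' s \<omega>) T \<le> l" by simp
        qed
        show "l \<le> running_max b0' B' T \<omega>"
          using run_max_upper[OF contB' r(1), of T] by (simp add: S'[OF r(1)] B'T Bf fT l_def)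
      qed
      then have coupled: "(B T \<omega>, running_max b0 B T \<omega>) = (B' T \<omega>, running_max b0' B' T \<omega>)"
        by (simp add: B'T S[OF r(1)] ST l_def)
      have "coupling_time b0 b0' B B' \<omega> = ereal T"
        unfolding coupling_time_def
      proof (rule antisym)
        show "Inf {ereal t |t. 0 \<le> t \<and> (B t \<omega>, running_max b0 B t \<omega>) = (B' t \<omega>, running_max b0' B' t \<omega>)} \<le> ereal T"
          by (rule Inf_lower) (use coupled r(1) in auto)
        show "ereal T \<le> Inf {ereal t |t. 0 \<le> t \<and> (B t \<omega>, running_max b0 B t \<omega>) = (B' t \<omega>, running_max b0' B' t \<omega>)}"
        proof (rule Inf_greatest)
          fix x assume "x \<in> {ereal t |t. 0 \<le> t \<and> (B t \<omega>, running_max b0 B t \<omega>) = (B' t \<omega>, running_max b0' B' t \<omega>)}"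
          then obtain t where t: "x = ereal t" "0 \<le> t"
            "(B t \<omega>, running_max b0 B t \<omega>) = (B' t \<omega>, running_max b0' B' t \<omega>)" by blast
          have "\<not> t < T"
          proof
            assume "t < T"
            from uncoupled[OF t(2)] r(3) this t(3) show False by force
          qed
          with t(1) show "ereal T \<le> x" by simp
        qed
      qed
      with hz show ?thesis
        by (simp add: exp_discount_def zero_discount_def T_def a_def[symmetric] f_def[abs_def, symmetric])
    qed
  qed
qed

text \<open>The identity with a functional of \<open>W\<close> holds almost surely, and the measure need not be complete.
  So measurability is derived from the definition on every path: the coupling time is the first zero
  of a continuous process.\<close>

lemma coupling_time_discount_measurable:
  assumes "reflection_synchronized_coupling M B B' b0 b0' s0 s0'" and \<alpha>: "0 < \<alpha>"
  shows "(\<lambda>\<omega>. exp_discount \<alpha> (coupling_time s0 s0' B B' \<omega>)) \<in> borel_measurable M"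
proof -
  interpret reflection_synchronized_coupling M B B' b0 b0' s0 s0' by (rule assms(1))
  define g where "g u \<omega> = \<bar>B u \<omega> - B' u \<omega>\<bar>
      + \<bar>max s0 (run_max (\<lambda>s. B s \<omega>) u) - max s0' (run_max (\<lambda>s. B' s \<omega>) u)\<bar>" for u \<omega>
  note cB = B.continuous_paths and cB' = B'.continuous_paths
  have cg: "continuous_on {0..} (\<lambda>u. g u \<omega>)" if "\<omega> \<in> space M" for \<omega>
    unfolding g_def
    by (intro continuous_intros cB[OF that] cB'[OF that] continuous_on_run_max)
  have "g u \<in> borel_measurable M" if u: "0 \<le> u" for u
  proof -
    have [measurable]: "B u \<in> borel_measurable M" "B' u \<in> borel_measurable M"
      "(\<lambda>\<omega>. run_max (\<lambda>s. B s \<omega>) u) \<in> borel_measurable M"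
      "(\<lambda>\<omega>. run_max (\<lambda>s. B' s \<omega>) u) \<in> borel_measurable M"
      using u by (auto intro!: run_max_measurable cB cB' B.random_variable_B B'.random_variable_B)
    show ?thesis unfolding g_def[abs_def] by measurable
  qed
  from measurable_zero_discount[OF cg this \<alpha>]
  have "(\<lambda>\<omega>. zero_discount \<alpha> (\<lambda>u. g u \<omega>)) \<in> borel_measurable M" .
  moreover have "zero_discount \<alpha> (\<lambda>u. g u \<omega>) = exp_discount \<alpha> (coupling_time s0 s0' B B' \<omega>)"
    if \<omega>: "\<omega> \<in> space M" for \<omega>
  proof -
    let ?Z = "{ereal t |t. 0 \<le> t \<and> (B t \<omega>, running_max s0 B t \<omega>) = (B' t \<omega>, running_max s0' B' t \<omega>)}"
    have Z: "?Z = {ereal t |t. 0 \<le> t \<and> g t \<omega> \<le> 0}"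
      by (auto simp: g_def running_max_def run_max_def)
    show ?thesis
    proof (cases "has_zero (\<lambda>u. g u \<omega>)")
      case True
      note z = has_zeroD[OF cg[OF \<omega>] True]
      have "Inf ?Z = ereal (first_zero (\<lambda>u. g u \<omega>))"
        unfolding Z
      proof (rule cInf_eq_minimum)
        fix x assume "x \<in> {ereal t |t. 0 \<le> t \<and> g t \<omega> \<le> 0}"
        then obtain t where t: "x = ereal t" "0 \<le> t" "g t \<omega> \<le> 0" by blast
        then show "ereal (first_zero (\<lambda>u. g u \<omega>)) \<le> x"
          using z(3)[of t] by (cases "t < first_zero (\<lambda>u. g u \<omega>)") auto
      qed (use z(1,2) in auto)
      then show ?thesis using True by (simp add: coupling_time_def exp_discount_def zero_discount_def)
    next
      case False
      then have "?Z = {}" unfolding Z by (auto simp: has_zero_def)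
      then have "coupling_time s0 s0' B B' \<omega> = Inf {}" unfolding coupling_time_def by presburger
      then show ?thesis using False by (simp add: exp_discount_def zero_discount_def top_ereal_def)
    qed
  qed
  ultimately show ?thesis by (rule measurable_cong[THEN iffD1, rotated])
qed

theorem theorem9:
  fixes M :: "'a measure" and B B' :: "real \<Rightarrow> 'a \<Rightarrow> real"
    and b0 b0' s0 s0' \<alpha> :: real
  assumes "reflection_synchronized_coupling M B B' b0 b0' s0 s0'"
    and "s0 = b0" and "b0 > b0'" and "b0' = s0'"
    and "\<alpha> > 0"
  shows "(\<integral>\<omega>. exp_discount \<alpha> (coupling_time s0 s0' B B' \<omega>) \<partial>M) =
    1 + sinh (sqrt (\<alpha> / 2) * (b0 - b0')) * ln (tanh (sqrt (\<alpha> / 2) * ((b0 - b0') / 2)))"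
proof -
  interpret reflection_synchronized_coupling M B B' b0 b0' s0 s0' by (rule assms(1))
  define a where "a = (b0 - b0') / 2"
  define c where "c = sqrt (2 * \<alpha>)"
  have a: "0 < a" and c: "0 < c" using assms by (simp_all add: a_def c_def)
  have c2: "c\<^sup>2 / 2 = \<alpha>" using assms(5) by (simp add: c_def)
  have ca: "c * a = sqrt (\<alpha> / 2) * (b0 - b0')"
  proof -
    have "sqrt (2 * \<alpha>) = sqrt (4 * (\<alpha> / 2))" by simp
    also have "\<dots> = 2 * sqrt (\<alpha> / 2)" by (subst real_sqrt_mult) simp
    finally show ?thesis by (simp add: c_def a_def)
  qed
  have ae: "AE \<omega> in M. exp_discount \<alpha> (coupling_time s0 s0' B B' \<omega>)
      = zero_discount \<alpha> (return_gap a (B.W_path \<omega>))"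
    using B.start B'.start reflection synchronization AE_space
  proof eventually_elim
    case (elim \<omega>)
    show ?case
      unfolding a_def B.W_def assms(2) assms(4)[symmetric]
      by (rule coupling_time_eq_return)
        (use elim assms B.continuous_paths B'.continuous_paths in \<open>auto\<close>)
  qed
  have "(\<integral>\<omega>. exp_discount \<alpha> (coupling_time s0 s0' B B' \<omega>) \<partial>M)
      = (\<integral>\<omega>. zero_discount \<alpha> (return_gap a (B.W_path \<omega>)) \<partial>M)"
  proof (rule integral_cong_AE[OF _ _ ae])
    show "(\<lambda>\<omega>. exp_discount \<alpha> (coupling_time s0 s0' B B' \<omega>)) \<in> borel_measurable M"
      by (rule coupling_time_discount_measurable[OF assms(1,5)])
    show "(\<lambda>\<omega>. zero_discount \<alpha> (return_gap a (B.W_path \<omega>))) \<in> borel_measurable M"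
      using B.return_expectation(1)[OF c a] unfolding c2 .
  qed
  also have "\<dots> = 1 + sinh (c * a) * ln (tanh (c * a / 2))"
    using B.return_laplace[OF c a] unfolding c2 .
  finally show ?thesis by (simp add: ca)
qed

end
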